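(* There exists an absolute constant $C_1>0$ such that the following holds. Let $s_*\in\{2,\dots,p\}$ be such that $\theta_*>0$ and $s_*\le p/(2e)$. Let $1\le q\le2$, $C_0=49(4+\sqrt2)/(4\theta_*^2)$, and let $\tilde{\boldsymbol\beta}$ be the adaptive estimator (depending on $q$) defined in the context. Then for all $s=1,\dots,s_*$, $$\sup_{\boldsymbol\beta^*\in B_0(s)}\mathbb P_{\boldsymbol\beta^*}\left(|\tilde{\boldsymbol\beta}-\boldsymbol\beta^*|_q\ge C_1C_0\,\sigma s^{1/q}\sqrt{\frac{\log(2ep/s)}n}\right)\le\big(2(\log_2(p))^2+1\big)\left(\frac{2s}p\right)^{2s}.$$
   Context: Let $n,p\ge1$ be integers, $\sigma>0$, and let $\mathbb X\in\mathbb R^{n\times p}$ be a deterministic matrix with $\|\mathbb X\boldsymbol e_j\|_n\le1$ for all $j=1,\dots,p$, where $(\boldsymbol e_j)$ is the canonical basis of $\mathbb R^p$ and $\|\boldsymbol u\|_n^2=\frac1n\sum_{i=1}^nu_i^2$. The model is $\mathbf y=\mathbb X\boldsymbol\beta^*+\boldsymbol\xi$ with $\boldsymbol\xi\sim\mathcal N(\mathbf 0,\sigma^2I_{n\times n})$, and $\mathbb P_{\boldsymbol\beta^*}$ is the corresponding probability measure. $|\cdot|_q$ is the $\ell_q$ norm on $\mathbb R^p$ and $B_0(s)=\{\boldsymbol\beta\in\mathbb R^p:|\boldsymbol\beta|_0\le s\}$, where $|\boldsymbol\beta|_0$ is the number of nonzero components. Set $\theta_*=\theta(2s_*,7)$,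 where $$\theta(s,c_0)=\min_{\boldsymbol\delta\ne\mathbf 0,\ |\boldsymbol\delta|_1\le(1+c_0)\sqrt s|\boldsymbol\delta|_2}\frac{\|\mathbb X\boldsymbol\delta\|_n}{|\boldsymbol\delta|_2}.$$ For $s\in\{1,\dots,p\}$, $\hat{\boldsymbol\beta}_s$ denotes the Lasso estimator, i.e. a solution of $\min_{\boldsymbol\beta\in\mathbb R^p}\big(\|\mathbb X\boldsymbol\beta-\mathbf y\|_n^2+2\lambda(s)|\boldsymbol\beta|_1\big)$, with $\lambda(s)=2(4+\sqrt2)\sigma\sqrt{\log(2ep/s)/n}$. Let $b_j=2^{j-1}$ for $j\in\mathbb N=\{1,2,\dots\}$ and $M=\max\{m\in\mathbb N:b_m\le s_*\}$ (so $M\ge2$). Let $d(\boldsymbol\beta,\boldsymbol\beta')=|\boldsymbol\beta-\boldsymbol\beta'|_q$ and $w(b)=C_0\sigma b^{1/q}\sqrt{\log(2ep/b)/n}$ for $b\in[1,p]$. Define $$\hat m=\min\big\{m\in\{2,\dots,M\}:d(\hat{\boldsymbol\beta}_{b_k},\hat{\boldsymbol\beta}_{b_{k-1}})\le2w(b_k)\ \text{for all }k\in\{m,\dots,M\}\big\},$$ with the convention $\hat m=M$ if this set is empty. The adaptive estimators are $$\hat s=b_{\hat m-1}=2^{\hat m-2},\qquad\tilde{\boldsymbol\beta}=\hat{\boldsymbol\beta}_{2\hat s}=\hat{\boldsymbol\beta}_{b_{\hat m}}.$$ *)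

theory Defs
  imports "HOL-Probability.Probability"
begin

text \<open>The dimensions have to be bound inside the scope of the absolute constant, so \<open>\<real>\<^sup>d\<close> is the
  set of extensional functions on \<open>{1..d}\<close>, which is the space of the product measure space
  \<open>borel_vec d\<close>. An \<open>n \<times> p\<close> matrix is a function of the row index and the column index.\<close>

definition rvec :: "nat \<Rightarrow> (nat \<Rightarrow> real) set" where
  "rvec d = {1..d} \<rightarrow>\<^sub>E UNIV"

definition borel_vec :: "nat \<Rightarrow> (nat \<Rightarrow> real) measure" where
  "borel_vec d = (\<Pi>\<^sub>M i\<in>{1..d}. borel)"

definition vsub :: "nat \<Rightarrow> (nat \<Rightarrow> real) \<Rightarrow> (nat \<Rightarrow> real) \<Rightarrow> nat \<Rightarrow> real" where
  "vsub d u v = (\<lambda>i\<in>{1..d}. u i - v i)"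

definition mat_vec :: "nat \<Rightarrow> nat \<Rightarrow> (nat \<Rightarrow> nat \<Rightarrow> real) \<Rightarrow> (nat \<Rightarrow> real) \<Rightarrow> nat \<Rightarrow> real" where
  "mat_vec n p X \<beta> = (\<lambda>i\<in>{1..n}. \<Sum>j=1..p. X i j * \<beta> j)"

definition unit_vec :: "nat \<Rightarrow> nat \<Rightarrow> nat \<Rightarrow> real" where
  "unit_vec p j = (\<lambda>k\<in>{1..p}. if k = j then 1 else 0)"

definition norm_n :: "nat \<Rightarrow> (nat \<Rightarrow> real) \<Rightarrow> real" where
  "norm_n n u = sqrt (1 / real n * (\<Sum>i=1..n. (u i)\<^sup>2))"

definition lq_norm :: "nat \<Rightarrow> real \<Rightarrow> (nat \<Rightarrow> real) \<Rightarrow> real" where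
  "lq_norm p q \<beta> = (\<Sum>j=1..p. \<bar>\<beta> j\<bar> powr q) powr (1 / q)"

definition l0_norm :: "nat \<Rightarrow> (nat \<Rightarrow> real) \<Rightarrow> nat" where
  "l0_norm p \<beta> = card {j \<in> {1..p}. \<beta> j \<noteq> 0}"

definition B0 :: "nat \<Rightarrow> nat \<Rightarrow> (nat \<Rightarrow> real) set" where
  "B0 p s = {\<beta> \<in> rvec p. l0_norm p \<beta> \<le> s}"

text \<open>For \<open>p, s \<ge> 1\<close> and \<open>c0 \<ge> 0\<close> the infimum is attained: the quotient is invariant under scaling,
  and the vectors of the cone on the unit sphere form a nonempty compact set.\<close>

definition theta :: "nat \<Rightarrow> nat \<Rightarrow> (nat \<Rightarrow> nat \<Rightarrow> real) \<Rightarrow> nat \<Rightarrow> real \<Rightarrow> real" where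
  "theta n p X s c0 =
     (INF \<delta> \<in> {\<delta> \<in> rvec p. (\<exists>j\<in>{1..p}. \<delta> j \<noteq> 0) \<and>
                  lq_norm p 1 \<delta> \<le> (1 + c0) * sqrt (real s) * lq_norm p 2 \<delta>}.
        norm_n n (mat_vec n p X \<delta>) / lq_norm p 2 \<delta>)"

definition gauss_noise :: "nat \<Rightarrow> real \<Rightarrow> (nat \<Rightarrow> real) measure" where
  "gauss_noise n \<sigma> = (\<Pi>\<^sub>M i\<in>{1..n}. density lborel (normal_density 0 \<sigma>))"

text \<open>The law of the observation \<open>y = X \<beta> + \<xi>\<close>; estimators are functions of \<open>y\<close>.\<close>

definition obs_law ::
    "nat \<Rightarrow> nat \<Rightarrow> real \<Rightarrow> (nat \<Rightarrow> nat \<Rightarrow> real) \<Rightarrow> (nat \<Rightarrow> real) \<Rightarrow> (nat \<Rightarrow> real) measure" where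
  "obs_law n p \<sigma> X \<beta> =
     distr (gauss_noise n \<sigma>) (borel_vec n) (\<lambda>\<xi>. \<lambda>i\<in>{1..n}. mat_vec n p X \<beta> i + \<xi> i)"

definition lambda :: "nat \<Rightarrow> nat \<Rightarrow> real \<Rightarrow> nat \<Rightarrow> real" where
  "lambda n p \<sigma> s = 2 * (4 + sqrt 2) * \<sigma> * sqrt (ln (2 * exp 1 * real p / real s) / real n)"

definition lasso_objective ::
    "nat \<Rightarrow> nat \<Rightarrow> (nat \<Rightarrow> nat \<Rightarrow> real) \<Rightarrow> real \<Rightarrow> (nat \<Rightarrow> real) \<Rightarrow> (nat \<Rightarrow> real) \<Rightarrow> real" where
  "lasso_objective n p X l y \<beta> = (norm_n n (vsub n (mat_vec n p X \<beta>) y))\<^sup>2 + 2 * l * lq_norm p 1 \<beta>"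

text \<open>The minimiser need not be unique; a Lasso estimator is any measurable choice of one.\<close>

definition lasso_estimator ::
    "nat \<Rightarrow> nat \<Rightarrow> (nat \<Rightarrow> nat \<Rightarrow> real) \<Rightarrow> real \<Rightarrow> ((nat \<Rightarrow> real) \<Rightarrow> nat \<Rightarrow> real) \<Rightarrow> bool" where
  "lasso_estimator n p X l est \<longleftrightarrow>
     est \<in> borel_vec n \<rightarrow>\<^sub>M borel_vec p \<and>
     (\<forall>y\<in>rvec n. is_arg_min (lasso_objective n p X l y) (\<lambda>\<beta>. \<beta> \<in> rvec p) (est y))"

definition bseq :: "nat \<Rightarrow> nat" where
  "bseq j = 2 ^ (j - 1)"

definition Mmax :: "nat \<Rightarrow> nat" where
  "Mmax sstar = Max {m. 1 \<le> m \<and> bseq m \<le> sstar}"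

definition wfun :: "nat \<Rightarrow> nat \<Rightarrow> real \<Rightarrow> real \<Rightarrow> real \<Rightarrow> real \<Rightarrow> real" where
  "wfun n p \<sigma> q C0 b =
     C0 * \<sigma> * b powr (1 / q) * sqrt (ln (2 * exp 1 * real p / b) / real n)"

text \<open>In the following definitions \<open>bhat s\<close> is the Lasso estimator with tuning parameter
  \<open>lambda n p \<sigma> s\<close>.\<close>

definition m_hat ::
    "nat \<Rightarrow> nat \<Rightarrow> real \<Rightarrow> real \<Rightarrow> real \<Rightarrow> nat \<Rightarrow> (nat \<Rightarrow> (nat \<Rightarrow> real) \<Rightarrow> nat \<Rightarrow> real)
      \<Rightarrow> (nat \<Rightarrow> real) \<Rightarrow> nat" where
  "m_hat n p \<sigma> q C0 sstar bhat y =
     (let S = {m \<in> {2..Mmax sstar}. \<forall>k\<in>{m..Mmax sstar}.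
                 lq_norm p q (vsub p (bhat (bseq k) y) (bhat (bseq (k - 1)) y))
                   \<le> 2 * wfun n p \<sigma> q C0 (real (bseq k))}
      in if S = {} then Mmax sstar else Min S)"

definition s_hat ::
    "nat \<Rightarrow> nat \<Rightarrow> real \<Rightarrow> real \<Rightarrow> real \<Rightarrow> nat \<Rightarrow> (nat \<Rightarrow> (nat \<Rightarrow> real) \<Rightarrow> nat \<Rightarrow> real)
      \<Rightarrow> (nat \<Rightarrow> real) \<Rightarrow> nat" where
  "s_hat n p \<sigma> q C0 sstar bhat y = bseq (m_hat n p \<sigma> q C0 sstar bhat y - 1)"

definition beta_tilde ::
    "nat \<Rightarrow> nat \<Rightarrow> real \<Rightarrow> real \<Rightarrow> real \<Rightarrow> nat \<Rightarrow> (nat \<Rightarrow> (nat \<Rightarrow> real) \<Rightarrow> nat \<Rightarrow> real)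
      \<Rightarrow> (nat \<Rightarrow> real) \<Rightarrow> nat \<Rightarrow> real" where
  "beta_tilde n p \<sigma> q C0 sstar bhat y = bhat (2 * s_hat n p \<sigma> q C0 sstar bhat y) y"

end

theory Submission imports Defs begin

text \<open>The constants in the tuning parameter and in \<open>C0\<close> are so generous that crude noise bounds suffice,
  as long as they do not depend on the dimension. Write \<open>\<mu> = \<sigma> sqrt (ln (2 e p / b) / n)\<close> for a value
  \<open>b\<close> of the grid, and let the true vector have at most \<open>s \<le> 2 b\<close> nonzero entries.

  \<^emph>\<open>One estimator.\<close> Call a noise vector regular for \<open>b\<close> if the correlations of the columns of \<open>X\<close> with it,
  divided by \<open>n\<close>, exceed \<open>sqrt 2 \<mu>\<close> in absolute value only by amounts whose squares add up to at most
  \<open>b \<mu>\<^sup>2\<close>. A Chernoff bound for each column and Markov's inequality show that noise is regular with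
  probability at least \<open>1/2\<close> (\<open>regular_noise_prob\<close>). If the noise lies within Euclidean distance \<open>r\<close> of
  a regular vector, where \<open>r\<^sup>2 \<le> 16 n b \<mu>\<^sup>2\<close>, then the Lasso tuned for \<open>b\<close> has an error of at most
  \<open>w(b)\<close>: the penalty dominates the regular part of the noise, and the quadratic term in the optimality
  condition absorbs the rest (\<open>lasso_error_bound\<close>). So the event that the error exceeds \<open>w(b)\<close> keeps the
  distance \<open>r\<close> from the regular vectors. Two sets of noise vectors at distance \<open>r\<close> satisfy
  \<open>P(E) P(K) \<le> exp (- r\<^sup>2 / (4 \<sigma>\<^sup>2))\<close> in every dimension (\<open>gaussian_separated_sets\<close>); with
  \<open>r\<^sup>2 = 8 \<sigma>\<^sup>2 s ln (p / (2 s))\<close> the right-hand side is \<open>(2 s / p) ^ (2 s)\<close>, which gives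
  \<open>lasso_deviation\<close>.

  \<^emph>\<open>Concentration.\<close> The inequality for separated sets is Maurey's argument: if
  \<open>F x * G y \<le> exp (|x - y|\<^sup>2 / (4 \<sigma>\<^sup>2))\<close> for all \<open>x\<close> and \<open>y\<close>, then the Gaussian integrals of \<open>F\<close> and
  \<open>G\<close> have a product of at most \<open>1\<close>. On the line this is the Prekopa-Leindler inequality, and the
  statement passes to products by integrating one coordinate at a time. Applied to multiples of
  indicators, it bounds probabilities without any regularity of the sets beyond measurability.

  \<^emph>\<open>Adaptation.\<close> Let \<open>m0\<close> be the first index from \<open>2\<close> on whose grid value \<open>b\<close> satisfies
  \<open>s \<le> 2 b\<close>. Outside a union of at
  most \<open>log 2 p\<close> events of the above kind, all estimators from \<open>m0\<close> on are within \<open>w\<close> of the truth. Then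
  the selected index is at most \<open>m0 + 1\<close>, and the definition of the selection bounds the distance from
  the selected estimator to the one at \<open>m0 + 1\<close> (or at the last index, if \<open>m0\<close> is the last one) by a sum
  of values of \<open>w\<close>. These grow geometrically, so
  that the sum is at most a multiple of its last term, which is comparable to \<open>w(s)\<close>
  (\<open>lepski_selection_error\<close>).\<close>

section \<open>The Prekopa-Leindler inequality on the line\<close>

text \<open>The set of all sums contains a translate of \<open>A\<close> by a point of \<open>B\<close> near its infimum and a translate of
  \<open>B\<close> by a point of \<open>A\<close> near its supremum. These overlap at most in a short interval, so the measures
  of \<open>A\<close> and \<open>B\<close> add up; passing to midpoints halves the measure.\<close>

lemma brunn_minkowski_midpoint_real:
  fixes A B C :: "real set"
  assumes meas: "A \<in> sets borel" "B \<in> sets borel" "C \<in> sets borel"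
    and ne: "A \<noteq> {}" "B \<noteq> {}" and bdd: "bdd_above A" "bdd_below B"
    and mid: "\<And>a b. a \<in> A \<Longrightarrow> b \<in> B \<Longrightarrow> (a + b) / 2 \<in> C"
  shows "emeasure lborel A + emeasure lborel B \<le> 2 * emeasure lborel C"
proof (rule ennreal_le_epsilon)
  fix e :: real assume e: "0 < e"
  note [measurable] = meas
  obtain a where a: "a \<in> A" "Sup A - e / 2 < a"
    using less_cSupD[of A "Sup A - e / 2"] ne e by auto
  obtain b where b: "b \<in> B" "b < Inf B + e / 2"
    using cInf_lessD[of B "Inf B + e / 2"] ne e by auto
  have A_le: "x < a + e / 2" if "x \<in> A" for x
    using cSup_upper[OF that bdd(1)] a by linarith
  have B_ge: "b - e / 2 < x" if "x \<in> B" for x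
    using cInf_lower[OF that bdd(2)] b by linarith
  \<comment> \<open>the part of \<open>A\<close> whose translate by \<open>b\<close> stays clear of the translate of \<open>B\<close> by \<open>a\<close>\<close>
  define P where "P = A \<inter> {..a - e / 2}"
  have [measurable]: "P \<in> sets borel" by (simp add: P_def meas)
  have shift: "emeasure lborel S = 2 * emeasure lborel {x. 2 * x - c \<in> S}"
    if [measurable]: "S \<in> sets borel" for S and c :: real
  proof -
    have "emeasure lborel S = (\<integral>\<^sup>+x. indicator S x \<partial>lborel)" by simp
    also have "\<dots> = 2 * (\<integral>\<^sup>+x. indicator S (- c + 2 * x) \<partial>lborel)"
      by (subst nn_integral_real_affine[where c = 2 and t = "- c"]) auto
    also have "(\<integral>\<^sup>+x. indicator S (- c + 2 * x) \<partial>lborel)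
        = (\<integral>\<^sup>+x. indicator {x. 2 * x - c \<in> S} x \<partial>lborel)"
      by (intro nn_integral_cong) (simp add: indicator_def)
    also have "\<dots> = emeasure lborel {x. 2 * x - c \<in> S}"
      by (intro nn_integral_indicator) measurable
    finally show ?thesis .
  qed
  have "emeasure lborel A \<le> emeasure lborel (P \<union> {a - e / 2..a + e / 2})"
    using A_le by (intro emeasure_mono) (force simp: P_def)+
  also have "\<dots> \<le> emeasure lborel P + emeasure lborel {a - e / 2..a + e / 2}"
    by (intro emeasure_subadditive) auto
  also have "\<dots> = emeasure lborel P + ennreal e"
    using e by simp
  finally have A_split: "emeasure lborel A \<le> emeasure lborel P + ennreal e" .
  have "emeasure lborel P + emeasure lborel B
      = 2 * (emeasure lborel {x. 2 * x - b \<in> P} + emeasure lborel {x. 2 * x - a \<in> B})"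
    using shift[of P b] shift[of B a] meas by (simp add: distrib_left)
  also have "emeasure lborel {x. 2 * x - b \<in> P} + emeasure lborel {x. 2 * x - a \<in> B}
      = emeasure lborel ({x. 2 * x - b \<in> P} \<union> {x. 2 * x - a \<in> B})"
  proof (rule plus_emeasure)
    show "{x. 2 * x - b \<in> P} \<inter> {x. 2 * x - a \<in> B} = {}"
      using B_ge by (force simp: P_def)
  qed measurable
  also have "\<dots> \<le> emeasure lborel C"
  proof (rule emeasure_mono)
    show "{x. 2 * x - b \<in> P} \<union> {x. 2 * x - a \<in> B} \<subseteq> C"
    proof
      fix x assume "x \<in> {x. 2 * x - b \<in> P} \<union> {x. 2 * x - a \<in> B}"
      then show "x \<in> C"
        using mid[of "2 * x - b" b] mid[of a "2 * x - a"] a b by (auto simp: P_def)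
    qed
  qed (simp add: meas)
  finally have "emeasure lborel P + emeasure lborel B \<le> 2 * emeasure lborel C"
    by (simp add: mult_left_mono)
  then show "emeasure lborel A + emeasure lborel B \<le> 2 * emeasure lborel C + ennreal e"
  proof -
    have "emeasure lborel A + emeasure lborel B \<le> emeasure lborel P + emeasure lborel B + ennreal e"
      using add_right_mono[OF A_split, of "emeasure lborel B"] by (simp add: ac_simps)
    also have "\<dots> \<le> 2 * emeasure lborel C + ennreal e"
      using \<open>emeasure lborel P + emeasure lborel B \<le> 2 * emeasure lborel C\<close> by (rule add_right_mono)
    finally show ?thesis .
  qed
qed

lemma nn_integral_layer_cake_real:
  fixes f :: "real \<Rightarrow> real"
  assumes [measurable]: "f \<in> borel_measurable borel" and "\<And>x. 0 \<le> f x"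
  shows "(\<integral>\<^sup>+x. f x \<partial>lborel) = (\<integral>\<^sup>+t. emeasure lborel {x. t < f x} * indicator {0..} t \<partial>lborel)"
proof -
  have "(\<integral>\<^sup>+x. f x \<partial>lborel) = (\<integral>\<^sup>+x. \<integral>\<^sup>+t. indicator {0..<f x} t \<partial>lborel \<partial>lborel)"
    using assms by simp
  also have "\<dots> = (\<integral>\<^sup>+x. \<integral>\<^sup>+t. (if 0 \<le> t \<and> t < f x then 1 else 0) \<partial>lborel \<partial>lborel)"
    by (intro nn_integral_cong) (auto simp: indicator_def)
  also have "\<dots> = (\<integral>\<^sup>+t. \<integral>\<^sup>+x. (if 0 \<le> t \<and> t < f x then 1 else 0) \<partial>lborel \<partial>lborel)"
    by (intro lborel_pair.Fubini') measurable
  also have "\<dots> = (\<integral>\<^sup>+t. emeasure lborel {x. t < f x} * indicator {0..} t \<partial>lborel)"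
  proof (rule nn_integral_cong)
    fix t :: real
    have "(\<integral>\<^sup>+x. (if 0 \<le> t \<and> t < f x then 1 else 0) \<partial>lborel)
        = (\<integral>\<^sup>+x. indicator {x. t < f x} x * indicator {0..} t \<partial>lborel)"
      by (intro nn_integral_cong) (auto simp: indicator_def)
    then show "(\<integral>\<^sup>+x. (if 0 \<le> t \<and> t < f x then 1 else 0) \<partial>lborel)
        = emeasure lborel {x. t < f x} * indicator {0..} t"
      by (simp add: nn_integral_multc)
  qed
  finally show ?thesis .
qed

text \<open>When both functions have supremum \<open>1\<close>, all their superlevel sets at levels below \<open>1\<close> are nonempty, and
  the midpoints of those at level \<open>t\<close> lie in the superlevel set of \<open>h\<close> at the same level. The set
  inequality can then be integrated over the levels; it gives an arithmetic mean, which is stronger than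
  the geometric mean of the usual statement.\<close>

lemma prekopa_leindler_normalised:
  fixes f g h :: "real \<Rightarrow> real"
  assumes [measurable]: "f \<in> borel_measurable borel" "g \<in> borel_measurable borel"
      "h \<in> borel_measurable borel"
    and nonneg: "\<And>x. 0 \<le> f x" "\<And>x. 0 \<le> g x" "\<And>x. 0 \<le> h x"
    and supp: "\<And>x. N < \<bar>x\<bar> \<Longrightarrow> f x = 0" "\<And>x. N < \<bar>x\<bar> \<Longrightarrow> g x = 0"
    and le1: "\<And>x. f x \<le> 1" "\<And>x. g x \<le> 1"
    and sup1: "\<And>t. t < 1 \<Longrightarrow> \<exists>x. t < f x" "\<And>t. t < 1 \<Longrightarrow> \<exists>x. t < g x"
    and mid: "\<And>x y. f x * g y \<le> (h ((x + y) / 2))\<^sup>2"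
  shows "(\<integral>\<^sup>+x. f x \<partial>lborel) + (\<integral>\<^sup>+x. g x \<partial>lborel) \<le> 2 * (\<integral>\<^sup>+x. h x \<partial>lborel)"
proof -
  have level: "emeasure lborel {x. t < f x} + emeasure lborel {x. t < g x}
      \<le> 2 * emeasure lborel {x. t < h x}" if t: "0 \<le> t" for t
  proof (cases "t < 1")
    case True
    show ?thesis
    proof (rule brunn_minkowski_midpoint_real)
      have "\<bar>x\<bar> \<le> N" if "t < f x" for x using supp(1)[of x] that t by force
      then show "bdd_above {x. t < f x}" by (intro bdd_aboveI[of _ N]) force
      have "\<bar>x\<bar> \<le> N" if "t < g x" for x using supp(2)[of x] that t by force
      then show "bdd_below {x. t < g x}" by (intro bdd_belowI[of _ "- N"]) force
    next
      fix a b assume ab: "a \<in> {x. t < f x}" "b \<in> {x. t < g x}"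
      then have "t\<^sup>2 < f a * g b"
        using t unfolding power2_eq_square by (intro mult_strict_mono') auto
      also have "\<dots> \<le> (h ((a + b) / 2))\<^sup>2" by (rule mid)
      finally show "(a + b) / 2 \<in> {x. t < h x}"
        using nonneg(3) t by (simp add: power_less_imp_less_base)
    qed (use sup1 True in \<open>auto simp: Collect_empty_eq\<close>)
  next
    case False
    then have "\<not> t < f x" "\<not> t < g x" for x
      using le1[of x] by linarith+
    then show ?thesis by simp
  qed
  have [measurable]: "(\<lambda>t. emeasure lborel {x. t < k x}) \<in> borel_measurable borel"
    if [measurable]: "k \<in> borel_measurable borel" for k :: "real \<Rightarrow> real"
  proof -
    have "{p \<in> space (borel \<Otimes>\<^sub>M lborel). fst p < k (snd p)} \<in> sets (borel \<Otimes>\<^sub>M lborel)"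
      by measurable
    from lborel.measurable_emeasure_Pair[OF this]
    show ?thesis by (simp add: vimage_def space_pair_measure)
  qed
  have "(\<integral>\<^sup>+x. f x \<partial>lborel) + (\<integral>\<^sup>+x. g x \<partial>lborel)
      = (\<integral>\<^sup>+t. (emeasure lborel {x. t < f x} + emeasure lborel {x. t < g x}) * indicator {0..} t \<partial>lborel)"
    using nonneg by (simp add: nn_integral_layer_cake_real nn_integral_add distrib_right)
  also have "\<dots> \<le> (\<integral>\<^sup>+t. 2 * (emeasure lborel {x. t < h x} * indicator {0..} t) \<partial>lborel)"
    using level by (intro nn_integral_mono) (auto simp: indicator_def)
  also have "\<dots> = 2 * (\<integral>\<^sup>+x. h x \<partial>lborel)"
    using nonneg by (simp add: nn_integral_layer_cake_real nn_integral_cmult)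
  finally show ?thesis .
qed

lemma ennreal_mult_le_square_of_add_le:
  fixes u v w :: ennreal
  assumes "u + v \<le> 2 * w"
  shows "u * v \<le> w * w"
proof (cases "w = \<top>")
  case False
  then obtain w' where w: "w = ennreal w'" "0 \<le> w'" by (cases w) auto
  then have "u + v \<le> ennreal (2 * w')" using assms by (simp add: ennreal_mult)
  then have "u < \<top>" "v < \<top>"
    by (metis add.commute ennreal_less_top le_less_trans le_iff_add)+
  then obtain u' v' where uv: "u = ennreal u'" "0 \<le> u'" "v = ennreal v'" "0 \<le> v'"
    by (cases u; cases v) auto
  then have le: "u' + v' \<le> 2 * w'" using \<open>u + v \<le> ennreal (2 * w')\<close> w
    by (simp add: ennreal_plus[symmetric] del: ennreal_plus)
  have "4 * (u' * v') \<le> (u' + v')\<^sup>2"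
    using zero_le_power2[of "u' - v'"] by (simp add: power2_eq_square algebra_simps)
  also have "\<dots> \<le> (2 * w')\<^sup>2" using le uv by (intro power_mono) auto
  finally have "u' * v' \<le> w' * w'" by (simp add: power2_eq_square)
  then show ?thesis using w uv by (simp add: ennreal_mult[symmetric])
qed (simp add: ennreal_top_mult)

text \<open>Dividing \<open>f\<close> and \<open>g\<close> by their suprema \<open>a\<close> and \<open>b\<close>, and \<open>h\<close> by \<open>sqrt (a b)\<close>, keeps the hypothesis and
  reduces to the normalised case; the arithmetic-geometric mean inequality removes the sum.\<close>

lemma prekopa_leindler_bounded:
  fixes f g h :: "real \<Rightarrow> real"
  assumes [measurable]: "f \<in> borel_measurable borel" "g \<in> borel_measurable borel"
      "h \<in> borel_measurable borel"
    and nonneg: "\<And>x. 0 \<le> f x" "\<And>x. 0 \<le> g x" "\<And>x. 0 \<le> h x"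
    and supp: "\<And>x. N < \<bar>x\<bar> \<Longrightarrow> f x = 0" "\<And>x. N < \<bar>x\<bar> \<Longrightarrow> g x = 0"
    and bdd: "\<And>x. f x \<le> B" "\<And>x. g x \<le> B"
    and mid: "\<And>x y. f x * g y \<le> (h ((x + y) / 2))\<^sup>2"
  shows "(\<integral>\<^sup>+x. f x \<partial>lborel) * (\<integral>\<^sup>+x. g x \<partial>lborel) \<le> (\<integral>\<^sup>+x. h x \<partial>lborel) * (\<integral>\<^sup>+x. h x \<partial>lborel)"
proof -
  have bdd': "bdd_above (range f)" "bdd_above (range g)"
    using bdd by (auto intro!: bdd_aboveI[of _ B])
  define a b where "a = Sup (range f)" and "b = Sup (range g)"
  have f_le: "f x \<le> a" and g_le: "g x \<le> b" for x
    using bdd' by (auto simp: a_def b_def intro!: cSup_upper)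
  show ?thesis
  proof (cases "a > 0 \<and> b > 0")
    case False
    then have "(\<forall>x. f x = 0) \<or> (\<forall>x. g x = 0)"
      using f_le g_le nonneg by (meson dual_order.antisym dual_order.trans not_less)
    then show ?thesis by auto
  next
    case True
    define c where "c = sqrt (a * b)"
    have pos: "a > 0" "b > 0" "c > 0" "c * c = a * b" using True by (auto simp: c_def)
    have near: "\<exists>x. t < f x / a" "\<exists>x. t < g x / b" if "t < 1" for t
      using less_cSupD[of "range f" "t * a"] less_cSupD[of "range g" "t * b"] that pos
      by (auto simp: a_def[symmetric] b_def[symmetric] field_simps)
    have "(\<integral>\<^sup>+x. f x / a \<partial>lborel) + (\<integral>\<^sup>+x. g x / b \<partial>lborel) \<le> 2 * (\<integral>\<^sup>+x. h x / c \<partial>lborel)"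
    proof (rule prekopa_leindler_normalised)
      fix x y
      have "f x / a * (g y / b) = f x * g y / (c * c)" using pos by simp
      also have "\<dots> \<le> (h ((x + y) / 2) / c)\<^sup>2"
        using mid[of x y] pos by (simp add: power_divide power2_eq_square divide_right_mono)
      finally show "f x / a * (g y / b) \<le> (h ((x + y) / 2) / c)\<^sup>2" .
    qed (use nonneg supp pos f_le g_le near in auto)
    then have "(\<integral>\<^sup>+x. f x / a \<partial>lborel) * (\<integral>\<^sup>+x. g x / b \<partial>lborel)
        \<le> (\<integral>\<^sup>+x. h x / c \<partial>lborel) * (\<integral>\<^sup>+x. h x / c \<partial>lborel)"
      by (rule ennreal_mult_le_square_of_add_le)
    then have le: "ennreal (a * b) * ((\<integral>\<^sup>+x. f x / a \<partial>lborel) * (\<integral>\<^sup>+x. g x / b \<partial>lborel))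
        \<le> ennreal (c * c) * ((\<integral>\<^sup>+x. h x / c \<partial>lborel) * (\<integral>\<^sup>+x. h x / c \<partial>lborel))"
      unfolding pos(4) by (intro mult_left_mono) auto
    have scale: "ennreal d * (\<integral>\<^sup>+x. k x / d \<partial>lborel) = (\<integral>\<^sup>+x. k x \<partial>lborel)"
      if "d > 0" "k \<in> borel_measurable borel" "\<And>x. 0 \<le> k x" for d and k :: "real \<Rightarrow> real"
      using that by (subst nn_integral_cmult[symmetric]) (auto simp: ennreal_mult[symmetric])
    have prod: "ennreal (d * e) * ((\<integral>\<^sup>+x. k x / d \<partial>lborel) * (\<integral>\<^sup>+x. l x / e \<partial>lborel))
        = (\<integral>\<^sup>+x. k x \<partial>lborel) * (\<integral>\<^sup>+x. l x \<partial>lborel)"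
      if "d > 0" "e > 0" "k \<in> borel_measurable borel" "l \<in> borel_measurable borel"
        "\<And>x. 0 \<le> k x" "\<And>x. 0 \<le> l x" for d e and k l :: "real \<Rightarrow> real"
    proof -
      have "ennreal (d * e) = ennreal d * ennreal e" using that by (simp add: ennreal_mult)
      moreover have "(x * y) * (z * w) = (x * z) * (y * w)" for x y z w :: ennreal
        by (simp add: mult_ac)
      ultimately have "ennreal (d * e) * ((\<integral>\<^sup>+x. k x / d \<partial>lborel) * (\<integral>\<^sup>+x. l x / e \<partial>lborel))
          = (ennreal d * (\<integral>\<^sup>+x. k x / d \<partial>lborel)) * (ennreal e * (\<integral>\<^sup>+x. l x / e \<partial>lborel))"
        by metis
      then show ?thesis
        by (simp only: scale[OF that(1,3,5)] scale[OF that(2,4,6)])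
    qed
    have "(\<integral>\<^sup>+x. f x \<partial>lborel) * (\<integral>\<^sup>+x. g x \<partial>lborel)
        = ennreal (a * b) * ((\<integral>\<^sup>+x. f x / a \<partial>lborel) * (\<integral>\<^sup>+x. g x / b \<partial>lborel))"
      by (rule prod[symmetric]) (simp_all add: pos nonneg)
    also note le
    also have "ennreal (c * c) * ((\<integral>\<^sup>+x. h x / c \<partial>lborel) * (\<integral>\<^sup>+x. h x / c \<partial>lborel))
        = (\<integral>\<^sup>+x. h x \<partial>lborel) * (\<integral>\<^sup>+x. h x \<partial>lborel)"
      by (rule prod) (simp_all add: pos nonneg)
    finally show ?thesis .
  qed
qed

section \<open>Gaussian concentration for separated sets\<close>

text \<open>The parallelogram identity in the exponent: the factor \<open>exp ((a - b)\<^sup>2 / (4 \<sigma>\<^sup>2))\<close> is exactly what turns a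
  hypothesis on \<open>f x * g y\<close> into the midpoint condition of Prekopa-Leindler for the Gaussian density.\<close>

lemma normal_density_mult_eq_midpoint:
  assumes "0 < \<sigma>"
  shows "exp ((a - b)\<^sup>2 / (4 * \<sigma>\<^sup>2)) * (normal_density 0 \<sigma> a * normal_density 0 \<sigma> b)
    = (normal_density 0 \<sigma> ((a + b) / 2))\<^sup>2"
proof -
  have "(a - b)\<^sup>2 / (4 * \<sigma>\<^sup>2) + (- (a\<^sup>2 / (2 * \<sigma>\<^sup>2)) + - (b\<^sup>2 / (2 * \<sigma>\<^sup>2)))
      = - (((a + b) / 2)\<^sup>2 / (2 * \<sigma>\<^sup>2)) + - (((a + b) / 2)\<^sup>2 / (2 * \<sigma>\<^sup>2))"
    using assms by (simp add: field_simps power2_eq_square)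
  then have "exp ((a - b)\<^sup>2 / (4 * \<sigma>\<^sup>2)) * (exp (- (a\<^sup>2 / (2 * \<sigma>\<^sup>2))) * exp (- (b\<^sup>2 / (2 * \<sigma>\<^sup>2))))
      = exp (- (((a + b) / 2)\<^sup>2 / (2 * \<sigma>\<^sup>2))) * exp (- (((a + b) / 2)\<^sup>2 / (2 * \<sigma>\<^sup>2)))"
    by (simp only: exp_add[symmetric])
  then show ?thesis
    by (simp add: normal_density_def power2_eq_square[of "_ / _"])
qed

lemma gaussian_property_tau_bounded:
  fixes f g :: "real \<Rightarrow> real"
  assumes \<sigma>: "0 < \<sigma>"
    and [measurable]: "f \<in> borel_measurable borel" "g \<in> borel_measurable borel"
    and nonneg: "\<And>x. 0 \<le> f x" "\<And>x. 0 \<le> g x"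
    and supp: "\<And>x. N < \<bar>x\<bar> \<Longrightarrow> f x = 0" "\<And>x. N < \<bar>x\<bar> \<Longrightarrow> g x = 0"
    and bdd: "\<And>x. f x \<le> B" "\<And>x. g x \<le> B"
    and mid: "\<And>x y. f x * g y \<le> exp ((x - y)\<^sup>2 / (4 * \<sigma>\<^sup>2))"
  defines "\<mu> \<equiv> density lborel (normal_density 0 \<sigma>)"
  shows "(\<integral>\<^sup>+x. f x \<partial>\<mu>) * (\<integral>\<^sup>+x. g x \<partial>\<mu>) \<le> 1"
proof -
  let ?\<phi> = "normal_density 0 \<sigma>"
  have phi: "0 \<le> ?\<phi> x" "?\<phi> x \<le> ?\<phi> 0" for x
    using \<sigma> by (auto simp: normal_density_def divide_right_mono)
  have "0 \<le> B" using nonneg(1)[of 0] bdd(1)[of 0] by linarith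
  have eq: "(\<integral>\<^sup>+x. ennreal (k x) \<partial>\<mu>) = (\<integral>\<^sup>+x. ennreal (k x * ?\<phi> x) \<partial>lborel)"
    if "k \<in> borel_measurable borel" "\<And>x. 0 \<le> k x" for k
    using that phi unfolding \<mu>_def
    by (subst nn_integral_density) (auto simp: ennreal_mult' mult_ac)
  have "(\<integral>\<^sup>+x. f x \<partial>\<mu>) * (\<integral>\<^sup>+x. g x \<partial>\<mu>)
      = (\<integral>\<^sup>+x. ennreal (f x * ?\<phi> x) \<partial>lborel) * (\<integral>\<^sup>+x. ennreal (g x * ?\<phi> x) \<partial>lborel)"
    using nonneg by (simp only: eq assms(2,3))
  also have "\<dots> \<le> (\<integral>\<^sup>+x. ?\<phi> x \<partial>lborel) * (\<integral>\<^sup>+x. ?\<phi> x \<partial>lborel)"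
  proof (rule prekopa_leindler_bounded)
    fix x y
    have "(f x * ?\<phi> x) * (g y * ?\<phi> y) = (f x * g y) * (?\<phi> x * ?\<phi> y)" by simp
    also have "\<dots> \<le> exp ((x - y)\<^sup>2 / (4 * \<sigma>\<^sup>2)) * (?\<phi> x * ?\<phi> y)"
      using mid phi by (intro mult_right_mono) auto
    also have "\<dots> = (?\<phi> ((x + y) / 2))\<^sup>2"
      by (rule normal_density_mult_eq_midpoint[OF \<sigma>])
    finally show "(f x * ?\<phi> x) * (g y * ?\<phi> y) \<le> (?\<phi> ((x + y) / 2))\<^sup>2" .
    show "f x * ?\<phi> x \<le> B * ?\<phi> 0" "g x * ?\<phi> x \<le> B * ?\<phi> 0"
      using bdd phi nonneg \<open>0 \<le> B\<close> by (auto intro!: mult_mono)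
  qed (use nonneg phi supp in auto)
  also have "(\<integral>\<^sup>+x. ?\<phi> x \<partial>lborel) = 1"
    using prob_space.emeasure_space_1[OF prob_space_normal_density[OF \<sigma>, of 0]]
    by (simp add: emeasure_density)
  finally show ?thesis by simp
qed

lemma SUP_nn_integral_truncation:
  fixes F :: "real \<Rightarrow> ennreal"
  assumes [measurable_cong]: "sets M = sets borel" and [measurable]: "F \<in> borel_measurable borel"
  shows "(\<integral>\<^sup>+x. F x \<partial>M)
    = (SUP N. \<integral>\<^sup>+x. enn2real (min (F x) (of_nat N)) * indicator {- real N..real N} x \<partial>M)"
    (is "_ = (SUP N. \<integral>\<^sup>+x. ennreal (?T N x) \<partial>M)")
proof -
  have T: "ennreal (?T N x) = min (F x) (of_nat N) * indicator {- real N..real N} x" for N x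
    by (auto simp: indicator_def min_def top_unique ennreal_of_nat_eq_real_of_nat
        intro!: ennreal_enn2real) (metis ennreal_of_nat_eq_real_of_nat ennreal_less_top le_less_trans less_top)
  have lim: "(SUP N. ennreal (?T N x)) = F x" for x
  proof (rule antisym)
    show "(SUP N. ennreal (?T N x)) \<le> F x"
      unfolding T by (intro SUP_least) (auto simp: indicator_def)
    obtain K :: nat where K: "\<bar>x\<bar> \<le> real K" using real_arch_simple by blast
    have "F x \<le> (SUP N. min (F x) (of_nat N))"
    proof -
      have "F x = inf (F x) (SUP N. of_nat N)" by (simp add: ennreal_SUP_of_nat_eq_top)
      also have "\<dots> = (SUP N. inf (F x) (of_nat N))" by (rule inf_SUP)
      finally show ?thesis by (simp add: inf_min)
    qed
    also have "\<dots> \<le> (SUP N. ennreal (?T N x))"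
    proof (rule SUP_least)
      fix N
      have "min (F x) (of_nat N) \<le> ennreal (?T (max N K) x)"
      proof -
        have "min (F x) (of_nat N) \<le> min (F x) (of_nat (max N K))"
          by (intro min.mono) (auto simp: of_nat_mono)
        moreover have "x \<in> {- real (max N K)..real (max N K)}"
          using K by (auto simp: abs_le_iff)
        ultimately show ?thesis unfolding T by simp
      qed
      then show "min (F x) (of_nat N) \<le> (SUP N. ennreal (?T N x))"
        by (rule order_trans) (rule SUP_upper, simp)
    qed
    finally show "F x \<le> (SUP N. ennreal (?T N x))" .
  qed
  have "(\<integral>\<^sup>+x. F x \<partial>M) = (\<integral>\<^sup>+x. (SUP N. ennreal (?T N x)) \<partial>M)"
    by (simp add: lim)
  also have "\<dots> = (SUP N. \<integral>\<^sup>+x. ennreal (?T N x) \<partial>M)"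
  proof (rule nn_integral_monotone_convergence_SUP)
    show "incseq (\<lambda>N x. ennreal (?T N x))"
      unfolding T by (auto simp: incseq_def le_fun_def indicator_def min_def intro: order_trans)
  qed measurable
  finally show ?thesis .
qed

text \<open>Maurey's property for the Gaussian measure on the line. The functions may be unbounded, so the
  inequality is proved for their truncations and carried over by monotone convergence.\<close>

lemma gaussian_property_tau:
  fixes F G :: "real \<Rightarrow> ennreal"
  assumes \<sigma>: "0 < \<sigma>"
    and [measurable]: "F \<in> borel_measurable borel" "G \<in> borel_measurable borel"
    and mid: "\<And>x y. F x * G y \<le> ennreal (exp ((x - y)\<^sup>2 / (4 * \<sigma>\<^sup>2)))"
  defines "\<mu> \<equiv> density lborel (normal_density 0 \<sigma>)"
  shows "(\<integral>\<^sup>+x. F x \<partial>\<mu>) * (\<integral>\<^sup>+x. G x \<partial>\<mu>) \<le> 1"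
proof -
  let ?T = "\<lambda>F N x. enn2real (min (F x) (of_nat N)) * indicator {- real N..real N} x"
  have ennreal_enn2real_le: "ennreal (enn2real (min u (of_nat N))) \<le> u" for u :: ennreal and N :: nat
    by (subst ennreal_enn2real)
      (auto simp: ennreal_of_nat_eq_real_of_nat min_less_iff_disj)
  have le: "?T F N x \<le> real (max N K)" "0 \<le> ?T F N x" for F :: "real \<Rightarrow> ennreal" and N K :: nat and x :: real
    by (auto simp: indicator_def intro!: enn2real_leI simp: ennreal_of_nat_eq_real_of_nat min_le_iff_disj)
  have "(\<integral>\<^sup>+x. ?T F N x \<partial>\<mu>) * (\<integral>\<^sup>+x. ?T G K x \<partial>\<mu>) \<le> 1" for N K :: nat
    unfolding \<mu>_def
  proof (rule gaussian_property_tau_bounded[OF \<sigma>])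
    fix x y
    have "ennreal (?T F N x) * ennreal (?T G K y) \<le> F x * G y"
      by (intro mult_mono) (auto simp: indicator_def intro!: ennreal_enn2real_le)
    then show "?T F N x * ?T G K y \<le> exp ((x - y)\<^sup>2 / (4 * \<sigma>\<^sup>2))"
      using mid[of x y] le(2) order_trans
      by (subst ennreal_le_iff[symmetric]) (auto simp: ennreal_mult intro: order_trans)
    show "?T F N x \<le> real (max N K)" by (rule le)
    show "?T G K x \<le> real (max N K)" using le(1)[where F = G and N = K and K = N and x = x] by (simp add: max.commute)
    show "?T F N x = 0" "?T G K x = 0" if "real (max N K) < \<bar>x\<bar>" for x
      using that by (auto simp: indicator_def)
  qed (auto simp: indicator_def)
  then have "(SUP N. \<integral>\<^sup>+x. ?T F N x \<partial>\<mu>) * (SUP K. \<integral>\<^sup>+x. ?T G K x \<partial>\<mu>) \<le> 1"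
    by (subst SUP_mult_right_ennreal, intro SUP_least, subst SUP_mult_left_ennreal, intro SUP_least)
  then show ?thesis
    using SUP_nn_integral_truncation[of \<mu> F] SUP_nn_integral_truncation[of \<mu> G]
    by (simp add: \<mu>_def)
qed

lemma prob_space_gauss_noise: "0 < \<sigma> \<Longrightarrow> prob_space (gauss_noise n \<sigma>)"
  unfolding gauss_noise_def by (intro prob_space_PiM prob_space_normal_density)

lemma space_gauss_noise: "space (gauss_noise n \<sigma>) = rvec n"
  by (simp add: gauss_noise_def space_PiM rvec_def)

text \<open>The property tensorises: for fixed last coordinates \<open>a\<close> and \<open>b\<close> the sections satisfy the hypothesis in the
  lower dimension up to the factor \<open>exp ((a - b)\<^sup>2 / (4 \<sigma>\<^sup>2))\<close>, so the integrals of the sections satisfy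
  the one-dimensional hypothesis.\<close>

lemma gaussian_property_tau_product:
  fixes F G :: "('i \<Rightarrow> real) \<Rightarrow> ennreal" and \<sigma> :: real
  defines "\<mu> \<equiv> density lborel (normal_density 0 \<sigma>)"
  assumes \<sigma>: "0 < \<sigma>" and "finite I"
    and "F \<in> borel_measurable (\<Pi>\<^sub>M i\<in>I. \<mu>)" "G \<in> borel_measurable (\<Pi>\<^sub>M i\<in>I. \<mu>)"
    and "\<And>x y. x \<in> I \<rightarrow>\<^sub>E UNIV \<Longrightarrow> y \<in> I \<rightarrow>\<^sub>E UNIV \<Longrightarrow>
      F x * G y \<le> ennreal (exp ((\<Sum>i\<in>I. (x i - y i)\<^sup>2) / (4 * \<sigma>\<^sup>2)))"
  shows "(\<integral>\<^sup>+x. F x \<partial>(\<Pi>\<^sub>M i\<in>I. \<mu>)) * (\<integral>\<^sup>+x. G x \<partial>(\<Pi>\<^sub>M i\<in>I. \<mu>)) \<le> 1"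
  using assms(3-)
proof (induction I arbitrary: F G rule: finite_induct)
  case empty
  then show ?case by (simp add: PiM_empty nn_integral_count_space_finite)
next
  case (insert i I)
  interpret \<mu>: prob_space \<mu> unfolding \<mu>_def by (rule prob_space_normal_density[OF \<sigma>])
  interpret product_sigma_finite "\<lambda>_::'i. \<mu>" by standard
  interpret I: finite_product_sigma_finite "\<lambda>_. \<mu>" I by standard (rule insert.hyps)
  note [measurable] = insert.prems(1,2)
  have [measurable_cong]: "sets \<mu> = sets borel" by (simp add: \<mu>_def)
  have sp: "space (\<Pi>\<^sub>M i\<in>J. \<mu>) = J \<rightarrow>\<^sub>E UNIV" for J :: "'i set"
    by (simp add: space_PiM \<mu>_def)
  define S where "S H a = (\<integral>\<^sup>+x. H (x(i := a)) \<partial>(\<Pi>\<^sub>M i\<in>I. \<mu>))" for H :: "('i \<Rightarrow> real) \<Rightarrow> ennreal" and a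
  have meas: "(\<lambda>p. H ((snd p)(i := fst p))) \<in> borel_measurable (\<mu> \<Otimes>\<^sub>M (\<Pi>\<^sub>M i\<in>I. \<mu>))"
    if [measurable]: "H \<in> borel_measurable (\<Pi>\<^sub>M i\<in>insert i I. \<mu>)" for H :: "('i \<Rightarrow> real) \<Rightarrow> ennreal"
    by measurable
  have sec: "(\<lambda>x. H (x(i := a))) \<in> borel_measurable (\<Pi>\<^sub>M i\<in>I. \<mu>)"
    if [measurable]: "H \<in> borel_measurable (\<Pi>\<^sub>M i\<in>insert i I. \<mu>)" for H :: "('i \<Rightarrow> real) \<Rightarrow> ennreal" and a
    using measurable_compose[OF measurable_Pair1' meas[OF that], of a] by (simp add: \<mu>_def)
  have S_meas: "S H \<in> borel_measurable borel"
    if [measurable]: "H \<in> borel_measurable (\<Pi>\<^sub>M i\<in>insert i I. \<mu>)" for H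
  proof -
    have "(\<lambda>a. \<integral>\<^sup>+x. H (x(i := a)) \<partial>(\<Pi>\<^sub>M i\<in>I. \<mu>)) \<in> borel_measurable \<mu>"
      using I.borel_measurable_nn_integral[of "\<lambda>a x. H (x(i := a))" \<mu>] meas[OF that]
      by (simp add: case_prod_beta')
    then show ?thesis by (simp add: S_def[abs_def] \<mu>_def)
  qed
  have S_mid: "S F a * S G b \<le> ennreal (exp ((a - b)\<^sup>2 / (4 * \<sigma>\<^sup>2)))" for a b
  proof -
    \<comment> \<open>the contribution of the new coordinate, moved to one side before the induction hypothesis is applied\<close>
    define c where "c = exp ((a - b)\<^sup>2 / (4 * \<sigma>\<^sup>2))"
    have c: "c > 0" "ennreal (inverse c) * ennreal c = 1"
      by (auto simp: c_def ennreal_mult[symmetric])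
    have "(\<integral>\<^sup>+x. ennreal (inverse c) * F (x(i := a)) \<partial>(\<Pi>\<^sub>M i\<in>I. \<mu>)) * (\<integral>\<^sup>+x. G (x(i := b)) \<partial>(\<Pi>\<^sub>M i\<in>I. \<mu>)) \<le> 1"
    proof (rule insert.IH)
      fix x y :: "'i \<Rightarrow> real" assume xy: "x \<in> I \<rightarrow>\<^sub>E UNIV" "y \<in> I \<rightarrow>\<^sub>E UNIV"
      let ?s = "\<Sum>j\<in>I. (x j - y j)\<^sup>2"
      have "x(i := a) \<in> insert i I \<rightarrow>\<^sub>E UNIV" "y(i := b) \<in> insert i I \<rightarrow>\<^sub>E UNIV"
        using xy by (auto simp: PiE_def extensional_def)
      from insert.prems(3)[OF this]
      moreover have "(\<Sum>j\<in>insert i I. ((x(i := a)) j - (y(i := b)) j)\<^sup>2) = (a - b)\<^sup>2 + ?s"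
        using insert.hyps by (subst sum.insert) (auto intro!: sum.cong)
      ultimately
      have "F (x(i := a)) * G (y(i := b)) \<le> ennreal (exp (((a - b)\<^sup>2 + ?s) / (4 * \<sigma>\<^sup>2)))"
        by (simp only:)
      also have "\<dots> = ennreal c * ennreal (exp (?s / (4 * \<sigma>\<^sup>2)))"
        by (simp add: c_def exp_add add_divide_distrib ennreal_mult)
      finally have "ennreal (inverse c) * (F (x(i := a)) * G (y(i := b)))
          \<le> ennreal (inverse c) * (ennreal c * ennreal (exp (?s / (4 * \<sigma>\<^sup>2))))"
        by (rule mult_left_mono) simp
      then show "ennreal (inverse c) * F (x(i := a)) * G (y(i := b)) \<le> ennreal (exp (?s / (4 * \<sigma>\<^sup>2)))"
        using c(2) by (metis mult.assoc mult_1)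
    next
      show "(\<lambda>x. ennreal (inverse c) * F (x(i := a))) \<in> borel_measurable (\<Pi>\<^sub>M i\<in>I. \<mu>)"
        using sec[OF insert.prems(1)] by (rule borel_measurable_times_ennreal[OF borel_measurable_const])
      show "(\<lambda>x. G (x(i := b))) \<in> borel_measurable (\<Pi>\<^sub>M i\<in>I. \<mu>)"
        by (rule sec[OF insert.prems(2)])
    qed
    then have "ennreal (inverse c) * (S F a * S G b) \<le> 1"
      unfolding S_def using sec[OF insert.prems(1)] by (simp only: nn_integral_cmult mult.assoc)
    then have "ennreal c * (ennreal (inverse c) * (S F a * S G b)) \<le> ennreal c * 1"
      by (rule mult_left_mono) simp
    moreover have "ennreal c * (ennreal (inverse c) * z) = z" for z
      using c(2) by (metis mult.assoc mult.commute mult_1)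
    ultimately show ?thesis by (simp only: c_def[symmetric] mult_1_right)
  qed
  have "(\<integral>\<^sup>+x. H x \<partial>(\<Pi>\<^sub>M i\<in>insert i I. \<mu>)) = (\<integral>\<^sup>+a. S H a \<partial>\<mu>)"
    if "H \<in> borel_measurable (\<Pi>\<^sub>M i\<in>insert i I. \<mu>)" for H
    unfolding S_def using that insert.hyps by (intro product_nn_integral_insert_rev) auto
  then show ?case
    using gaussian_property_tau[OF \<sigma> S_meas[OF insert.prems(1)] S_meas[OF insert.prems(2)] S_mid] insert.prems
    by (simp add: \<mu>_def)
qed

text \<open>Take \<open>F\<close> to be a multiple of the indicator of \<open>E\<close> and \<open>G\<close> the indicator of \<open>K\<close>. The bound does not depend
  on \<open>n\<close>.\<close>

lemma gaussian_separated_sets: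
  assumes \<sigma>: "0 < \<sigma>"
    and [measurable]: "E \<in> sets (gauss_noise n \<sigma>)" "K \<in> sets (gauss_noise n \<sigma>)"
    and far: "\<And>x y. x \<in> E \<Longrightarrow> y \<in> K \<Longrightarrow> r \<le> (\<Sum>i=1..n. (x i - y i)\<^sup>2)"
  shows "measure (gauss_noise n \<sigma>) E * measure (gauss_noise n \<sigma>) K \<le> exp (- (r / (4 * \<sigma>\<^sup>2)))"
proof -
  interpret prob_space "gauss_noise n \<sigma>" by (rule prob_space_gauss_noise[OF \<sigma>])
  let ?c = "exp (r / (4 * \<sigma>\<^sup>2))"
  let ?G = "gauss_noise n \<sigma>"
  have "(\<integral>\<^sup>+x. ennreal ?c * indicator E x \<partial>?G) * (\<integral>\<^sup>+x. indicator K x \<partial>?G) \<le> 1"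
    unfolding gauss_noise_def
  proof (rule gaussian_property_tau_product[OF \<sigma>])
    fix x y :: "nat \<Rightarrow> real"
    have "ennreal ?c \<le> ennreal (exp ((\<Sum>i=1..n. (x i - y i)\<^sup>2) / (4 * \<sigma>\<^sup>2)))" if "x \<in> E" "y \<in> K"
      using far[OF that] by (intro ennreal_leI) (auto intro!: divide_right_mono)
    then show "ennreal ?c * indicator E x * indicator K y
        \<le> ennreal (exp ((\<Sum>i=1..n. (x i - y i)\<^sup>2) / (4 * \<sigma>\<^sup>2)))"
      by (auto simp: indicator_def)
  qed (use assms in \<open>auto simp: gauss_noise_def\<close>)
  then have "ennreal (?c * (prob E * prob K)) \<le> 1"
    by (simp add: nn_integral_cmult emeasure_eq_measure ennreal_mult[symmetric] mult.assoc)
  then have "?c * (prob E * prob K) \<le> 1" by (simp add: ennreal_le_1)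
  then show ?thesis by (simp add: exp_minus field_simps)
qed

section \<open>Norms and the restricted eigenvalue\<close>

text \<open>Weighted arithmetic-geometric mean, as \<open>q\<close> is the combination of the exponents \<open>1\<close> and \<open>2\<close> with weights
  \<open>2 - q\<close> and \<open>q - 1\<close>.\<close>

lemma powr_le_linear_quadratic:
  fixes v q :: real
  assumes "0 \<le> v" "1 \<le> q" "q \<le> 2"
  shows "v powr q \<le> (2 - q) * v + (q - 1) * v\<^sup>2"
proof (cases "v = 0")
  case False
  then have v: "0 < v" using assms by simp
  have "v powr q = v powr (2 - q) * (v powr 2) powr (q - 1)"
    by (simp add: powr_powr flip: powr_add)
  also have "\<dots> = v powr (2 - q) * v\<^sup>2 powr (q - 1)" using v by simp
  also have "\<dots> \<le> (2 - q) * v + (q - 1) * v\<^sup>2"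
    using v assms by (intro Youngs_inequality_0) auto
  finally show ?thesis .
qed (use assms in auto)

lemma lq_norm_nonneg: "0 \<le> lq_norm p q u"
  by (simp add: lq_norm_def)

lemma lq_norm_cong: "(\<And>j. j \<in> {1..p} \<Longrightarrow> \<bar>u j\<bar> = \<bar>v j\<bar>) \<Longrightarrow> lq_norm p q u = lq_norm p q v"
  unfolding lq_norm_def by (intro arg_cong[where f = "\<lambda>S. S powr _"] sum.cong) auto

lemma lq_norm_1: "lq_norm p 1 u = (\<Sum>j=1..p. \<bar>u j\<bar>)"
  by (simp add: lq_norm_def sum_nonneg)

lemma lq_norm_2: "lq_norm p 2 u = sqrt (\<Sum>j=1..p. (u j)\<^sup>2)"
  by (simp add: lq_norm_def powr_half_sqrt sum_nonneg)

lemma lq_norm_eq_0_iff: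
  assumes "0 < q"
  shows "lq_norm p q u = 0 \<longleftrightarrow> (\<forall>j\<in>{1..p}. u j = 0)"
  using assms by (auto simp: lq_norm_def sum_nonneg_eq_0_iff)

text \<open>Rescaling by \<open>c\<close> makes both hypotheses bounds by \<open>b\<close>, and the pointwise inequality
  \<open>powr_le_linear_quadratic\<close> can be summed. This is how the bounds on the errors in the first and second
  norm give all values of \<open>q\<close> in between.\<close>

lemma lq_norm_interpolation:
  assumes q: "1 \<le> q" "q \<le> 2" and c: "0 < c" "0 < b"
    and l1: "(\<Sum>j=1..p. \<bar>u j\<bar>) \<le> c * b" and l2: "(\<Sum>j=1..p. (u j)\<^sup>2) \<le> c\<^sup>2 * b"
  shows "lq_norm p q u \<le> c * b powr (1 / q)"
proof -
  have "(\<Sum>j=1..p. (\<bar>u j\<bar> / c) powr q)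
      \<le> (\<Sum>j=1..p. (2 - q) * (\<bar>u j\<bar> / c) + (q - 1) * (\<bar>u j\<bar> / c)\<^sup>2)"
    using q c by (intro sum_mono powr_le_linear_quadratic) auto
  also have "\<dots> = (2 - q) * ((\<Sum>j=1..p. \<bar>u j\<bar>) / c) + (q - 1) * ((\<Sum>j=1..p. (u j)\<^sup>2) / c\<^sup>2)"
    by (simp add: sum.distrib sum_distrib_left sum_divide_distrib power_divide)
  also have "\<dots> \<le> (2 - q) * b + (q - 1) * b"
    using q c l1 l2 by (intro add_mono mult_left_mono) (auto simp: field_simps)
  also have "\<dots> = b" by (simp add: algebra_simps)
  finally have le: "(\<Sum>j=1..p. (\<bar>u j\<bar> / c) powr q) \<le> b" .
  have "(\<Sum>j=1..p. \<bar>u j\<bar> powr q) = c powr q * (\<Sum>j=1..p. (\<bar>u j\<bar> / c) powr q)"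
    using c by (simp add: powr_divide sum_divide_distrib[symmetric])
  also have "\<dots> \<le> c powr q * b" using le by (intro mult_left_mono) auto
  finally have "lq_norm p q u \<le> (c powr q * b) powr (1 / q)"
    unfolding lq_norm_def using q by (intro powr_mono2) (auto intro!: sum_nonneg)
  also have "\<dots> = c * b powr (1 / q)"
    using q c by (simp add: powr_mult powr_powr)
  finally show ?thesis .
qed

text \<open>Convexity up to the boundary point \<open>0\<close>, where entries of a vector may lie.\<close>

lemma powr_convex_nonneg:
  fixes x y t q :: real
  assumes "1 \<le> q" "0 \<le> x" "0 \<le> y" "0 \<le> t" "t \<le> 1"
  shows "(t * x + (1 - t) * y) powr q \<le> t * x powr q + (1 - t) * y powr q"
proof -
  have shrink: "(a * z) powr q \<le> a * z powr q" if "0 \<le> a" "a \<le> 1" "0 \<le> z" for a z :: real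
  proof (cases "a = 0")
    case False
    then have "a powr q \<le> a powr 1" using that assms by (intro powr_mono') auto
    then show ?thesis using that by (simp add: powr_mult mult_right_mono)
  qed simp
  consider "x = 0" | "y = 0" | "0 < x" "0 < y" using assms by fastforce
  then show ?thesis
  proof cases
    case 3
    then show ?thesis
      using powr_convex[OF assms(1)] assms convex_onD[of "{0<..}" "\<lambda>x. x powr q" "1 - t" x y]
      by (simp add: algebra_simps)
  qed (use shrink assms in auto)
qed

text \<open>Minkowski's inequality: after division by the norms, the entries of the sum are convex combinations of
  the entries of the normalised vectors.\<close>

lemma lq_norm_triangle:
  assumes q: "1 \<le> q"
  shows "lq_norm p q (\<lambda>j. u j + v j) \<le> lq_norm p q u + lq_norm p q v"
proof -
  let ?A = "lq_norm p q u" and ?B = "lq_norm p q v"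
  consider "?A = 0" | "?B = 0" | "0 < ?A" "0 < ?B"
    using lq_norm_nonneg[of p q u] lq_norm_nonneg[of p q v] by fastforce
  then show ?thesis
  proof cases
    case 1
    then have "lq_norm p q (\<lambda>j. u j + v j) = ?B"
      using q by (intro lq_norm_cong) (auto simp: lq_norm_eq_0_iff)
    then show ?thesis using 1 by simp
  next
    case 2
    then have "lq_norm p q (\<lambda>j. u j + v j) = ?A"
      using q by (intro lq_norm_cong) (auto simp: lq_norm_eq_0_iff)
    then show ?thesis using 2 by simp
  next
    case 3
    let ?S = "?A + ?B" and ?t = "?A / (?A + ?B)"
    have normed: "(\<Sum>j=1..p. (\<bar>w j\<bar> / lq_norm p q w) powr q) = 1" if "0 < lq_norm p q w" for w
    proof -
      have "lq_norm p q w powr q = (\<Sum>j=1..p. \<bar>w j\<bar> powr q)"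
        using q by (simp add: lq_norm_def powr_powr sum_nonneg)
      moreover have "(\<Sum>j=1..p. (\<bar>w j\<bar> / lq_norm p q w) powr q)
          = (\<Sum>j=1..p. \<bar>w j\<bar> powr q) / lq_norm p q w powr q"
        using that by (simp add: powr_divide sum_divide_distrib)
      ultimately have "(\<Sum>j=1..p. (\<bar>w j\<bar> / lq_norm p q w) powr q)
          = lq_norm p q w powr q / lq_norm p q w powr q" by (simp only:)
      then show ?thesis using that by simp
    qed
    have "(\<Sum>j=1..p. \<bar>u j + v j\<bar> powr q)
        \<le> (\<Sum>j=1..p. ?S powr q * (?t * (\<bar>u j\<bar> / ?A) powr q + (1 - ?t) * (\<bar>v j\<bar> / ?B) powr q))"
    proof (rule sum_mono)
      fix j
      have t: "?t * (\<bar>u j\<bar> / ?A) + (1 - ?t) * (\<bar>v j\<bar> / ?B) = (\<bar>u j\<bar> + \<bar>v j\<bar>) / ?S"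
      proof -
        have "1 - ?t = ?B / ?S" using 3 by (simp add: field_simps)
        then show ?thesis using 3 by (simp add: add_divide_distrib)
      qed
      have "\<bar>u j + v j\<bar> powr q \<le> (?S * ((\<bar>u j\<bar> + \<bar>v j\<bar>) / ?S)) powr q"
        using 3 q by (intro powr_mono2) auto
      also have "\<dots> = ?S powr q * (?t * (\<bar>u j\<bar> / ?A) + (1 - ?t) * (\<bar>v j\<bar> / ?B)) powr q"
        unfolding t using 3 by (intro powr_mult) 
      also have "\<dots> \<le> ?S powr q * (?t * (\<bar>u j\<bar> / ?A) powr q + (1 - ?t) * (\<bar>v j\<bar> / ?B) powr q)"
        using 3 q by (intro mult_left_mono powr_convex_nonneg) auto
      finally show "\<bar>u j + v j\<bar> powr q
          \<le> ?S powr q * (?t * (\<bar>u j\<bar> / ?A) powr q + (1 - ?t) * (\<bar>v j\<bar> / ?B) powr q)" .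
    qed
    also have "\<dots> = ?S powr q * (?t * (\<Sum>j=1..p. (\<bar>u j\<bar> / ?A) powr q)
        + (1 - ?t) * (\<Sum>j=1..p. (\<bar>v j\<bar> / ?B) powr q))"
      by (simp only: sum_distrib_left[symmetric] sum.distrib)
    also have "\<dots> = ?S powr q" by (simp only: normed 3) simp
    finally have "lq_norm p q (\<lambda>j. u j + v j) \<le> (?S powr q) powr (1 / q)"
      unfolding lq_norm_def using q by (intro powr_mono2) (auto intro!: sum_nonneg)
    also have "\<dots> = ?S" using q 3 by (simp add: powr_powr)
    finally show ?thesis .
  qed
qed

lemma lq_norm_vsub_triangle:
  assumes "1 \<le> q"
  shows "lq_norm p q (vsub p a c) \<le> lq_norm p q (vsub p a b) + lq_norm p q (vsub p b c)"
  using lq_norm_triangle[OF assms, of p "vsub p a b" "vsub p b c"]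
  by (subst lq_norm_cong[of p "vsub p a c" "\<lambda>j. vsub p a b j + vsub p b c j"]) (auto simp: vsub_def)

lemma lq_norm_vsub_commute: "lq_norm p q (vsub p a b) = lq_norm p q (vsub p b a)"
  by (intro lq_norm_cong) (auto simp: vsub_def)

lemma norm_n_sq: "(norm_n n u)\<^sup>2 = (\<Sum>i=1..n. (u i)\<^sup>2) / real n"
  by (simp add: norm_n_def sum_nonneg)

lemma norm_n_nonneg: "0 \<le> norm_n n u"
  by (simp add: norm_n_def sum_nonneg)

lemma theta_mult_le:
  assumes "\<delta> \<in> rvec p" "lq_norm p 1 \<delta> \<le> (1 + c0) * sqrt (real s) * lq_norm p 2 \<delta>"
  shows "theta n p X s c0 * lq_norm p 2 \<delta> \<le> norm_n n (mat_vec n p X \<delta>)"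
proof (cases "\<exists>j\<in>{1..p}. \<delta> j \<noteq> 0")
  case True
  then have pos: "0 < lq_norm p 2 \<delta>"
    using lq_norm_nonneg[of p 2 \<delta>] lq_norm_eq_0_iff[of 2 p \<delta>] by fastforce
  have "theta n p X s c0 \<le> norm_n n (mat_vec n p X \<delta>) / lq_norm p 2 \<delta>"
    unfolding theta_def using assms True
    by (intro cINF_lower bdd_belowI[of _ 0]) (auto simp: norm_n_nonneg lq_norm_nonneg)
  then show ?thesis using pos by (simp add: field_simps)
next
  case False
  then have "lq_norm p 2 \<delta> = 0" by (simp add: lq_norm_eq_0_iff)
  then show ?thesis by (simp add: norm_n_nonneg)
qed

text \<open>A standard basis vector lies in the cone, and its image has norm at most \<open>1\<close>. This is what allows additive
  constants in the error bound to be compared with \<open>1 / \<theta>\<^sup>2\<close>.\<close>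

lemma theta_le_1:
  assumes "1 \<le> p" "1 \<le> s" "0 \<le> c0"
    and col: "norm_n n (mat_vec n p X (unit_vec p 1)) \<le> 1"
  shows "theta n p X s c0 \<le> 1"
proof -
  have supp: "(\<Sum>j=1..p. f (unit_vec p 1 j)) = f 1" if "f 0 = 0" for f :: "real \<Rightarrow> real"
  proof -
    have "(\<Sum>j=1..p. f (unit_vec p 1 j)) = (\<Sum>j=1..p. if j = 1 then f 1 else 0)"
      using that by (intro sum.cong) (auto simp: unit_vec_def)
    then show ?thesis using assms by simp
  qed
  have norms: "lq_norm p 1 (unit_vec p 1) = 1" "lq_norm p 2 (unit_vec p 1) = 1"
    using supp[of abs] supp[of "\<lambda>x. x\<^sup>2"] by (auto simp: lq_norm_1 lq_norm_2)
  have "1 * 1 \<le> (1 + c0) * sqrt (real s)" using assms by (intro mult_mono) auto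
  then have "theta n p X s c0 * lq_norm p 2 (unit_vec p 1) \<le> norm_n n (mat_vec n p X (unit_vec p 1))"
    by (intro theta_mult_le) (simp_all only: norms mult_1_right, simp add: rvec_def unit_vec_def)
  then show ?thesis using col norms by simp
qed

section \<open>A deterministic error bound for the Lasso\<close>

text \<open>Comparing the minimiser with the points of the segment towards \<open>\<beta>\<close> and letting them tend to the minimiser
  gains a factor \<open>2\<close> in front of the quadratic term over a comparison with \<open>\<beta>\<close> alone.\<close>

lemma lasso_first_order:
  assumes l: "0 \<le> l" and \<beta>: "\<beta> \<in> rvec p"
    and min: "is_arg_min (lasso_objective n p X l (\<lambda>i\<in>{1..n}. mat_vec n p X \<beta> i + \<xi> i)) (\<lambda>\<beta>. \<beta> \<in> rvec p) \<gamma>"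
  defines "v \<equiv> mat_vec n p X (vsub p \<gamma> \<beta>)"
  shows "(\<Sum>i=1..n. (v i)\<^sup>2) / n \<le> (\<Sum>i=1..n. \<xi> i * v i) / n
    + l * ((\<Sum>j=1..p. \<bar>\<beta> j\<bar>) - (\<Sum>j=1..p. \<bar>\<gamma> j\<bar>))"
proof -
  let ?y = "\<lambda>i\<in>{1..n}. mat_vec n p X \<beta> i + \<xi> i"
  let ?V = "\<Sum>i=1..n. (v i)\<^sup>2" and ?W = "\<Sum>i=1..n. \<xi> i * v i"
  let ?R = "\<Sum>i=1..n. (v i - \<xi> i)\<^sup>2"
  let ?N0 = "\<Sum>j=1..p. \<bar>\<beta> j\<bar>" and ?N1 = "\<Sum>j=1..p. \<bar>\<gamma> j\<bar>"
  have bound: "?V / n - ?W / n - l * (?N0 - ?N1) \<le> t * (?V / n)" if t: "0 < t" "t \<le> 1" for t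
  proof -
    define \<gamma>t where "\<gamma>t = (\<lambda>j\<in>{1..p}. \<gamma> j - t * (\<gamma> j - \<beta> j))"
    have "\<gamma>t \<in> rvec p" by (simp add: \<gamma>t_def rvec_def)
    have fit: "vsub n (mat_vec n p X g) ?y i = v i - r * v i - \<xi> i"
      if i: "i \<in> {1..n}" and g: "\<And>j. j \<in> {1..p} \<Longrightarrow> g j = \<gamma> j - r * (\<gamma> j - \<beta> j)" for g r i
    proof -
      have "(\<Sum>j=1..p. X i j * g j) = (\<Sum>j=1..p. X i j * (\<gamma> j - r * (\<gamma> j - \<beta> j)))"
        using g by (intro sum.cong) auto
      then show ?thesis
        using i by (simp add: vsub_def mat_vec_def v_def algebra_simps sum_subtractf sum_distrib_left sum.distrib)
    qed
    have obj: "lasso_objective n p X l ?y \<gamma> \<le> lasso_objective n p X l ?y \<gamma>t"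
      using min \<open>\<gamma>t \<in> rvec p\<close> by (force simp: is_arg_min_def not_less)
    have obj_\<gamma>: "lasso_objective n p X l ?y \<gamma> = ?R / n + 2 * l * ?N1"
    proof -
      have "(\<Sum>i=1..n. (vsub n (mat_vec n p X \<gamma>) ?y i)\<^sup>2) = ?R"
        using fit[of _ \<gamma> 0] by (intro sum.cong) auto
      then show ?thesis by (simp only: lasso_objective_def norm_n_sq lq_norm_1)
    qed
    have obj_\<gamma>t: "lasso_objective n p X l ?y \<gamma>t
        = (\<Sum>i=1..n. (v i - t * v i - \<xi> i)\<^sup>2) / n + 2 * l * (\<Sum>j=1..p. \<bar>\<gamma>t j\<bar>)"
    proof -
      have "(\<Sum>i=1..n. (vsub n (mat_vec n p X \<gamma>t) ?y i)\<^sup>2) = (\<Sum>i=1..n. (v i - t * v i - \<xi> i)\<^sup>2)"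
        using fit[of _ \<gamma>t t] by (intro sum.cong) (auto simp: \<gamma>t_def)
      then show ?thesis by (simp only: lasso_objective_def norm_n_sq lq_norm_1)
    qed
    have square: "(\<Sum>i=1..n. (v i - t * v i - \<xi> i)\<^sup>2) = ?R - 2 * t * (?V - ?W) + t\<^sup>2 * ?V"
      by (simp add: sum_distrib_left power2_eq_square algebra_simps sum_subtractf sum.distrib)
    have "(\<Sum>j=1..p. \<bar>\<gamma>t j\<bar>) \<le> (\<Sum>j=1..p. (1 - t) * \<bar>\<gamma> j\<bar> + t * \<bar>\<beta> j\<bar>)"
    proof (rule sum_mono)
      fix j assume "j \<in> {1..p}"
      then have "\<gamma>t j = (1 - t) * \<gamma> j + t * \<beta> j" by (simp add: \<gamma>t_def algebra_simps)
      then show "\<bar>\<gamma>t j\<bar> \<le> (1 - t) * \<bar>\<gamma> j\<bar> + t * \<bar>\<beta> j\<bar>"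
        using t abs_triangle_ineq[of "(1 - t) * \<gamma> j" "t * \<beta> j"] by (simp add: abs_mult)
    qed
    also have "\<dots> = (1 - t) * ?N1 + t * ?N0" by (simp add: sum.distrib sum_distrib_left)
    finally have "2 * l * (\<Sum>j=1..p. \<bar>\<gamma>t j\<bar>) \<le> 2 * l * ((1 - t) * ?N1 + t * ?N0)"
      using l by (intro mult_left_mono) auto
    then have "?R / n + 2 * l * ?N1
        \<le> (?R - 2 * t * (?V - ?W) + t\<^sup>2 * ?V) / n + 2 * l * ((1 - t) * ?N1 + t * ?N0)"
      using obj unfolding obj_\<gamma> obj_\<gamma>t square by linarith
    then have "0 \<le> (- 2 * t * (?V - ?W) + t\<^sup>2 * ?V) / n + 2 * l * (t * (?N0 - ?N1))"
      by (simp add: algebra_simps add_divide_distrib diff_divide_distrib)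
    then have "0 \<le> t * (- 2 * (?V / n - ?W / n) + t * (?V / n) + 2 * l * (?N0 - ?N1))"
      by (simp add: algebra_simps add_divide_distrib diff_divide_distrib power2_eq_square)
    then have "0 \<le> - 2 * (?V / n - ?W / n) + t * (?V / n) + 2 * (l * (?N0 - ?N1))"
      using t by (simp add: zero_le_mult_iff mult.assoc)
    moreover have "0 \<le> t * (?V / n)" using t by (simp add: sum_nonneg)
    moreover have "c - d - e \<le> w" if "0 \<le> - 2 * (c - d) + w + 2 * e" "0 \<le> w" for c d e w :: real
      using that by (simp add: algebra_simps)
    ultimately show ?thesis by blast
  qed
  have "?V / n - ?W / n - l * (?N0 - ?N1) \<le> 0 + e" if e: "0 < e" for e
  proof -
    \<comment> \<open>small enough for the remaining quadratic term to be below \<open>e\<close>\<close>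
    let ?t = "min 1 (e / (?V / n + 1))"
    have V: "0 \<le> ?V / n" by (simp add: sum_nonneg)
    have "?t * (?V / n) \<le> e / (?V / n + 1) * (?V / n + 1)"
      using V e by (intro mult_mono) auto
    then show ?thesis using bound[of ?t] V e by simp
  qed
  then have "?V / n - ?W / n - l * (?N0 - ?N1) \<le> 0" by (rule field_le_epsilon)
  then show ?thesis by simp
qed

text \<open>The optimality condition after scaling: \<open>x\<close> stands for the Euclidean norm of the error, \<open>P\<close> and \<open>R\<close> for
  the sums of its absolute values on and off the support of the true vector, and \<open>V\<close> for the squared
  prediction error. Inside the cone the restricted eigenvalue makes \<open>V\<close> quadratic in \<open>x\<close>, so the linear
  terms bound \<open>x\<close>; the bound on \<open>P + R\<close> comes from maximising a concave quadratic. Outside the cone \<open>R\<close> is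
  large compared with \<open>x\<close>, and its negative coefficient bounds everything by an absolute constant.\<close>

lemma lasso_quadratic_bounds:
  fixes x P R V \<theta> :: real
  defines "C \<equiv> 49 * (4 + sqrt 2) / (4 * \<theta>\<^sup>2)"
  assumes \<theta>: "0 < \<theta>" "\<theta> \<le> 1" and nonneg: "0 \<le> x" "0 \<le> P" "0 \<le> R" "0 \<le> V"
    and P: "P \<le> sqrt 2 * x"
    and main: "V / 2 \<le> (8 + 3 * sqrt 2) * P - (8 + sqrt 2) * R + x + 8"
    and cone: "P + R \<le> 8 * sqrt 2 * x \<Longrightarrow> \<theta>\<^sup>2 * x\<^sup>2 \<le> V"
  shows "x \<le> C" "P + R \<le> C"
proof -
  define r where "r = sqrt (2::real)"
  have r: "r * r = 2" by (simp add: r_def)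
  have "1.4 \<le> r" unfolding r_def by (rule real_le_rsqrt) (simp add: power2_eq_square)
  moreover have "r \<le> 1.5" unfolding r_def by (rule real_le_lsqrt) (simp_all add: power2_eq_square)
  ultimately have r: "r * r = 2" "1.4 \<le> r" "r \<le> 1.5" using r by auto
  define y where "y = \<theta>\<^sup>2"
  have y: "0 < y" "y \<le> 1" using \<theta> by (auto simp: y_def power_le_one)
  have C: "C * y = 49 * (4 + r) / 4" using y by (simp add: C_def r_def y_def field_simps)
  \<comment> \<open>all numerical estimates below rest on \<open>66 \<le> C\<close>, the value of \<open>C * y\<close> and \<open>1.4 \<le> r \<le> 1.5\<close>\<close>
  have "C * y \<le> C * 1" using y by (intro mult_left_mono) (auto simp: C_def)
  then have C66: "66 \<le> C" using C r by simp
  have "(8 + 3 * r) * P \<le> (8 + 3 * r) * (r * x)" using P r by (intro mult_left_mono) (auto simp: r_def)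
  also have "\<dots> = (8 * r + 6) * x" using r(1) by (simp add: algebra_simps)
  finally have main': "V / 2 \<le> (8 * r + 7) * x - (8 + r) * R + 8"
    using main by (simp add: r_def algebra_simps)
  have "x \<le> C \<and> P + R \<le> C"
  proof (cases "P + R \<le> 8 * r * x")
    case True
    then have V: "y * x\<^sup>2 \<le> V" using cone by (simp add: r_def y_def)
    have R: "(8 + r) * R \<le> (8 * r + 7) * x + 8 - y * x\<^sup>2 / 2" using main' V by linarith
    have rx: "r * x \<le> 1.5 * x" using r nonneg by (intro mult_right_mono) auto
    have "x \<le> C"
    proof (rule ccontr)
      assume "\<not> x \<le> C"
      then have "y * C * x \<le> y * x * x" using y nonneg by (intro mult_right_mono mult_left_mono) auto
      then have "49 * (4 + r) / 4 * x \<le> y * x\<^sup>2" using C by (simp add: power2_eq_square mult_ac)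
      moreover have "66 * x \<le> 49 * (4 + r) / 4 * x" using r nonneg by (intro mult_right_mono) auto
      moreover have "0 \<le> (8 + r) * R" using r nonneg by simp
      ultimately have "33 * x \<le> 19 * x + 8" using R rx by (simp add: algebra_simps)
      then show False using \<open>\<not> x \<le> C\<close> C66 by linarith
    qed
    moreover have "P + R \<le> C"
    proof -
      have "(8 + r) * P \<le> (8 + r) * (r * x)" using P r by (intro mult_left_mono) (auto simp: r_def)
      also have "\<dots> = (8 * r + 2) * x" using r(1) by (simp add: algebra_simps)
      finally have "(8 + r) * (P + R) \<le> 33 * x + 8 - y * x\<^sup>2 / 2"
        using R rx by (simp add: algebra_simps)
      then have "y * ((8 + r) * (P + R)) \<le> y * (33 * x + 8 - y * x\<^sup>2 / 2)"
        using y by (intro mult_left_mono) auto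
      also have "\<dots> \<le> 545 + 8 * y"
        using zero_le_power2[of "y * x - 33"] by (simp add: power2_eq_square algebra_simps)
      also have "\<dots> \<le> 553" using y by simp
      also have "\<dots> \<le> (8 + r) * (y * C)"
      proof -
        have "9.4 * 66 \<le> (8 + r) * (49 * (4 + r) / 4)" using r by (intro mult_mono) auto
        then have "553 \<le> (8 + r) * (49 * (4 + r) / 4)" by linarith
        moreover have "y * C = 49 * (4 + r) / 4" using C by (simp add: mult.commute)
        ultimately show ?thesis by (simp only:)
      qed
      finally have "(8 + r) * y * (P + R) \<le> (8 + r) * y * C" by (simp add: mult_ac)
      then show ?thesis using r y by (simp add: mult_le_cancel_left_pos)
    qed
    ultimately show ?thesis ..
  next
    case False
    have rx: "1.4 * x \<le> r * x" "r * x \<le> 1.5 * x" using r nonneg by (intro mult_right_mono; auto)+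
    then have "11.2 * x \<le> P + R" using False by simp
    moreover have "P \<le> r * x" using P by (simp add: r_def)
    moreover have "9.4 * R \<le> (8 + r) * R" using r nonneg by (intro mult_right_mono) auto
    moreover have "(8 + r) * R \<le> (8 * r + 7) * x + 8" using main' nonneg by linarith
    ultimately have "x \<le> 66 \<and> P + R \<le> 66" using rx nonneg by (simp add: algebra_simps) 
    then show ?thesis using C66 by auto
  qed
  then show "x \<le> C" "P + R \<le> C" by auto
qed

text \<open>A bound for every noise vector \<open>\<xi>\<close> that is close to a regular vector \<open>a\<close>. The inner product of \<open>a\<close> with \<open>X u\<close>
  is at most \<open>\<mu> (sqrt 2 |u|\<^sub>1 + sqrt b |u|\<^sub>2)\<close>, by splitting each correlation into its part below
  \<open>sqrt 2 \<mu>\<close> and its excess, and the inner product of \<open>\<xi> - a\<close> with \<open>X u\<close> is estimated by half the sum of the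
  squares. In the units \<open>sqrt b \<mu>\<close> and \<open>b \<mu>\<close> the optimality condition has the form treated in
  \<open>lasso_quadratic_bounds\<close>.\<close>

lemma lasso_error_bound:
  fixes n p s sstar b :: nat and \<sigma> q \<mu> \<theta> :: real and X :: "nat \<Rightarrow> nat \<Rightarrow> real"
  defines "\<mu> \<equiv> \<sigma> * sqrt (ln (2 * exp 1 * real p / real b) / real n)"
    and "\<theta> \<equiv> theta n p X (2 * sstar) 7"
  assumes n: "1 \<le> n" and p: "1 \<le> p" and \<sigma>: "0 < \<sigma>"
    and col: "\<forall>j\<in>{1..p}. norm_n n (mat_vec n p X (unit_vec p j)) \<le> 1"
    and \<theta>: "0 < \<theta>" and b: "1 \<le> b" "b \<le> sstar" "b \<le> p" and q: "1 \<le> q" "q \<le> 2"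
    and \<beta>: "\<beta> \<in> B0 p s" "s \<le> 2 * b"
    and min: "is_arg_min (lasso_objective n p X (lambda n p \<sigma> b) (\<lambda>i\<in>{1..n}. mat_vec n p X \<beta> i + \<xi> i))
        (\<lambda>\<beta>. \<beta> \<in> rvec p) \<gamma>"
    and regular: "(\<Sum>j=1..p. (max 0 (\<bar>(\<Sum>i=1..n. X i j * a i) / n\<bar> - sqrt 2 * \<mu>))\<^sup>2) \<le> b * \<mu>\<^sup>2"
    and close: "(\<Sum>i=1..n. (\<xi> i - a i)\<^sup>2) / n \<le> 16 * b * \<mu>\<^sup>2"
  shows "lq_norm p q (vsub p \<gamma> \<beta>) \<le> wfun n p \<sigma> q (49 * (4 + sqrt 2) / (4 * \<theta>\<^sup>2)) (real b)"
proof -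
  define C where "C = 49 * (4 + sqrt 2) / (4 * \<theta>\<^sup>2)"
  have "1 < exp 1 * (2 * real p / real b)"
    using b one_less_exp_iff[of "1::real"] by (intro less_1_mult') (auto simp: field_simps)
  then have ln_pos: "0 < ln (2 * exp 1 * real p / real b)" by (simp add: mult_ac)
  then have \<mu>: "0 < \<mu>" using n \<sigma> by (simp add: \<mu>_def)
  have b0: "0 < real b" "0 < sqrt (real b)" using b by auto
  define u where "u = vsub p \<gamma> \<beta>"
  define v where "v = mat_vec n p X u"
  define S where "S = {j \<in> {1..p}. \<beta> j \<noteq> 0}"
  define P where "P = (\<Sum>j\<in>S. \<bar>u j\<bar>)"
  define R where "R = (\<Sum>j\<in>{1..p} - S. \<bar>u j\<bar>)"
  define x where "x = lq_norm p 2 u"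
  define V where "V = (\<Sum>i=1..n. (v i)\<^sup>2) / n"
  have S: "S \<subseteq> {1..p}" "finite S" "card S \<le> 2 * b"
    using \<beta> by (auto simp: S_def B0_def l0_norm_def)
  have \<beta>_rvec: "\<beta> \<in> rvec p" using \<beta> by (simp add: B0_def)
  have nonneg: "0 \<le> P" "0 \<le> R" "0 \<le> x" "0 \<le> V"
    by (auto simp: P_def R_def x_def V_def lq_norm_nonneg sum_nonneg)
  have split: "(\<Sum>j=1..p. f j) = (\<Sum>j\<in>S. f j) + (\<Sum>j\<in>{1..p} - S. f j)" for f :: "nat \<Rightarrow> real"
    using S by (subst sum.subset_diff[of S]) auto
  have N: "(\<Sum>j=1..p. \<bar>u j\<bar>) = P + R" unfolding P_def R_def by (rule split)
  have x_sq: "(\<Sum>j=1..p. (u j)\<^sup>2) = x\<^sup>2" by (simp add: x_def lq_norm_2 sum_nonneg)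
  have norms: "(\<Sum>j=1..p. \<bar>\<beta> j\<bar>) - (\<Sum>j=1..p. \<bar>\<gamma> j\<bar>) \<le> P - R"
  proof -
    have "(\<Sum>j\<in>S. \<bar>\<beta> j\<bar>) \<le> (\<Sum>j\<in>S. \<bar>\<gamma> j\<bar> + \<bar>u j\<bar>)"
      using S(1) by (intro sum_mono) (auto simp: u_def vsub_def)
    moreover have "(\<Sum>j\<in>{1..p} - S. \<bar>\<beta> j\<bar>) = 0" by (auto simp: S_def)
    moreover have "(\<Sum>j\<in>{1..p} - S. \<bar>\<gamma> j\<bar>) = R"
      unfolding R_def by (intro sum.cong) (auto simp: S_def u_def vsub_def)
    ultimately show ?thesis unfolding split P_def by (simp add: sum.distrib)
  qed
  have P_le: "P \<le> sqrt 2 * (sqrt b * x)"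
  proof -
    have "P\<^sup>2 \<le> (\<Sum>j\<in>S. 1\<^sup>2) * (\<Sum>j\<in>S. \<bar>u j\<bar>\<^sup>2)"
      using Cauchy_Schwarz_ineq_sum[of "\<lambda>_. 1" "\<lambda>j. \<bar>u j\<bar>" S] by (simp add: P_def)
    also have "\<dots> \<le> (2 * real b) * x\<^sup>2"
    proof (intro mult_mono)
      show "(\<Sum>j\<in>S. 1\<^sup>2) \<le> 2 * real b" using S(3) by (simp add: of_nat_mono[of "card S" "2 * b", simplified])
      show "(\<Sum>j\<in>S. \<bar>u j\<bar>\<^sup>2) \<le> x\<^sup>2"
        unfolding x_sq[symmetric] split by (simp add: sum_nonneg)
    qed (auto simp: sum_nonneg)
    also have "\<dots> = (sqrt 2 * (sqrt b * x))\<^sup>2" by (simp add: power_mult_distrib)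
    finally show ?thesis by (rule power2_le_imp_le) (simp add: nonneg)
  qed
  define z where "z j = (\<Sum>i=1..n. X i j * a i) / n" for j
  define e where "e j = max 0 (\<bar>z j\<bar> - sqrt 2 * \<mu>)" for j
  have e_bound: "(\<Sum>j=1..p. e j * \<bar>u j\<bar>) \<le> sqrt b * \<mu> * x"
  proof -
    have "(\<Sum>j=1..p. e j * \<bar>u j\<bar>)\<^sup>2 \<le> (\<Sum>j=1..p. (e j)\<^sup>2) * (\<Sum>j=1..p. \<bar>u j\<bar>\<^sup>2)"
      by (rule Cauchy_Schwarz_ineq_sum)
    also have "\<dots> \<le> (b * \<mu>\<^sup>2) * x\<^sup>2"
      using regular x_sq by (intro mult_mono) (auto simp: e_def z_def sum_nonneg)
    also have "\<dots> = (sqrt b * \<mu> * x)\<^sup>2" by (simp add: power_mult_distrib)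
    finally show ?thesis by (rule power2_le_imp_le) (use nonneg \<mu> in auto)
  qed
  have noise_a: "(\<Sum>i=1..n. a i * v i) / n \<le> sqrt 2 * \<mu> * (P + R) + sqrt b * \<mu> * x"
  proof -
    have "(\<Sum>i=1..n. a i * v i) = (\<Sum>i=1..n. \<Sum>j=1..p. a i * X i j * u j)"
      by (intro sum.cong) (auto simp: v_def mat_vec_def sum_distrib_left mult.assoc)
    also have "\<dots> = (\<Sum>j=1..p. \<Sum>i=1..n. a i * X i j * u j)" by (rule sum.swap)
    finally have "(\<Sum>i=1..n. a i * v i) / n = (\<Sum>j=1..p. \<Sum>i=1..n. a i * X i j * u j) / n" by simp
    also have "\<dots> = (\<Sum>j=1..p. (\<Sum>i=1..n. a i * X i j * u j) / n)" by (rule sum_divide_distrib)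
    also have "\<dots> = (\<Sum>j=1..p. z j * u j)"
      by (intro sum.cong) (auto simp: z_def sum_distrib_left mult_ac)
    also have "\<dots> \<le> (\<Sum>j=1..p. sqrt 2 * \<mu> * \<bar>u j\<bar> + e j * \<bar>u j\<bar>)"
    proof (rule sum_mono)
      fix j
      have "z j * u j \<le> \<bar>z j\<bar> * \<bar>u j\<bar>" by (metis abs_ge_self abs_mult)
      also have "\<dots> \<le> (sqrt 2 * \<mu> + e j) * \<bar>u j\<bar>" by (intro mult_right_mono) (auto simp: e_def)
      finally show "z j * u j \<le> sqrt 2 * \<mu> * \<bar>u j\<bar> + e j * \<bar>u j\<bar>" by (simp add: algebra_simps)
    qed
    also have "\<dots> = sqrt 2 * \<mu> * (P + R) + (\<Sum>j=1..p. e j * \<bar>u j\<bar>)"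
      by (simp only: sum.distrib sum_distrib_left[symmetric] N)
    finally show ?thesis using e_bound by linarith
  qed
  have noise_rest: "(\<Sum>i=1..n. (\<xi> i - a i) * v i) / n \<le> 8 * b * \<mu>\<^sup>2 + V / 2"
  proof -
    have "(\<Sum>i=1..n. (\<xi> i - a i) * v i) \<le> (\<Sum>i=1..n. ((\<xi> i - a i)\<^sup>2 + (v i)\<^sup>2) / 2)"
    proof (rule sum_mono)
      have "c * d \<le> (c\<^sup>2 + d\<^sup>2) / 2" for c d :: real
        using sum_squares_bound[of c d] by simp
      then show "(\<xi> i - a i) * v i \<le> ((\<xi> i - a i)\<^sup>2 + (v i)\<^sup>2) / 2" for i .
    qed
    then have "(\<Sum>i=1..n. (\<xi> i - a i) * v i) / n \<le> (\<Sum>i=1..n. ((\<xi> i - a i)\<^sup>2 + (v i)\<^sup>2) / 2) / n"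
      by (rule divide_right_mono) simp
    also have "\<dots> = (\<Sum>i=1..n. (\<xi> i - a i)\<^sup>2) / n / 2 + V / 2"
      by (simp add: V_def sum_divide_distrib[symmetric] sum.distrib add_divide_distrib)
    finally show ?thesis using close by simp
  qed
  have "V \<le> (\<Sum>i=1..n. \<xi> i * v i) / n + lambda n p \<sigma> b * ((\<Sum>j=1..p. \<bar>\<beta> j\<bar>) - (\<Sum>j=1..p. \<bar>\<gamma> j\<bar>))"
    unfolding V_def v_def u_def using ln_pos \<sigma>
    by (intro lasso_first_order[OF _ \<beta>_rvec min]) (simp add: lambda_def)
  also have "(\<Sum>i=1..n. \<xi> i * v i) / n
      = (\<Sum>i=1..n. a i * v i) / n + (\<Sum>i=1..n. (\<xi> i - a i) * v i) / n"
    by (simp add: algebra_simps sum_subtractf diff_divide_distrib)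
  also have "lambda n p \<sigma> b = 2 * (4 + sqrt 2) * \<mu>" by (simp add: lambda_def \<mu>_def)
  finally have "V \<le> (sqrt 2 * \<mu> * (P + R) + sqrt b * \<mu> * x) + (8 * b * \<mu>\<^sup>2 + V / 2)
      + 2 * (4 + sqrt 2) * \<mu> * (P - R)"
    using noise_a noise_rest mult_left_mono[OF norms, of "2 * (4 + sqrt 2) * \<mu>"] \<mu> by simp
  then have main: "V / 2 \<le> (8 + 3 * sqrt 2) * (\<mu> * P) - (8 + sqrt 2) * (\<mu> * R) + \<mu> * (sqrt b * x) + 8 * b * \<mu>\<^sup>2"
    by (simp add: algebra_simps)
  \<comment> \<open>the unit in which squared prediction errors are measured\<close>
  define k where "k = b * \<mu>\<^sup>2"
  have k: "0 < k" using b0 \<mu> by (simp add: k_def)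
  have scaled: "sqrt b * x / (b * \<mu>) \<le> C" "P / (b * \<mu>) + R / (b * \<mu>) \<le> C"
  proof -
    note bounds = lasso_quadratic_bounds[of \<theta> "sqrt b * x / (b * \<mu>)" "P / (b * \<mu>)" "R / (b * \<mu>)" "V / k",
        folded C_def]
    have \<theta>1: "\<theta> \<le> 1" unfolding \<theta>_def using col p b by (intro theta_le_1) auto
    have nn: "0 \<le> sqrt b * x / (b * \<mu>)" "0 \<le> P / (b * \<mu>)" "0 \<le> R / (b * \<mu>)" "0 \<le> V / k"
      using nonneg \<mu> k by auto
    have 1: "P / (b * \<mu>) \<le> sqrt 2 * (sqrt b * x / (b * \<mu>))"
      using divide_right_mono[OF P_le, of "b * \<mu>"] \<mu> by simp
    have 2: "V / k / 2 \<le> (8 + 3 * sqrt 2) * (P / (b * \<mu>)) - (8 + sqrt 2) * (R / (b * \<mu>))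
        + sqrt b * x / (b * \<mu>) + 8"
    proof -
      have "t / (b * \<mu>) = \<mu> * t / k" for t
        using \<mu> b0 by (simp add: k_def power2_eq_square)
      then show ?thesis
        using divide_right_mono[OF main, of k] k
        by (simp add: k_def[symmetric] add_divide_distrib diff_divide_distrib mult.assoc)
    qed
    have 3: "\<theta>\<^sup>2 * (sqrt b * x / (b * \<mu>))\<^sup>2 \<le> V / k"
      if "P / (b * \<mu>) + R / (b * \<mu>) \<le> 8 * sqrt 2 * (sqrt b * x / (b * \<mu>))"
    proof -
      have "(P + R) / (b * \<mu>) \<le> (8 * sqrt 2 * (sqrt b * x)) / (b * \<mu>)"
        using that by (simp add: add_divide_distrib)
      then have "P + R \<le> 8 * sqrt 2 * (sqrt b * x)"
        using \<mu> b0 by (simp add: divide_le_cancel)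
      also have "\<dots> = 8 * sqrt (real (2 * b)) * x" by (simp add: real_sqrt_mult)
      also have "\<dots> \<le> 8 * sqrt (real (2 * sstar)) * x"
        using b nonneg by (intro mult_right_mono mult_left_mono) auto
      finally have "lq_norm p 1 u \<le> (1 + 7) * sqrt (real (2 * sstar)) * lq_norm p 2 u"
        unfolding lq_norm_1 N x_def[symmetric] by simp
      then have "\<theta> * x \<le> norm_n n v"
        unfolding \<theta>_def x_def v_def by (intro theta_mult_le) (auto simp: u_def vsub_def rvec_def)
      then have "(\<theta> * x)\<^sup>2 \<le> (norm_n n v)\<^sup>2" using \<theta> nonneg by (intro power_mono) auto
      then have "\<theta>\<^sup>2 * x\<^sup>2 \<le> V" by (simp add: norm_n_sq V_def power_mult_distrib)
      then have "\<theta>\<^sup>2 * x\<^sup>2 / k \<le> V / k" using k by (simp add: divide_right_mono)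
      moreover have "\<theta>\<^sup>2 * (sqrt b * x / (b * \<mu>))\<^sup>2 = \<theta>\<^sup>2 * x\<^sup>2 / k"
        using b0 by (simp add: k_def power_mult_distrib power_divide power2_eq_square[of "real b"])
      ultimately show ?thesis by simp
    qed
    show "sqrt b * x / (b * \<mu>) \<le> C" "P / (b * \<mu>) + R / (b * \<mu>) \<le> C"
      using bounds[OF \<theta> \<theta>1 nn 1 2 3] by blast+
  qed
  have C: "0 < C" using \<theta> by (simp add: C_def add_pos_nonneg)
  have "lq_norm p q u \<le> (C * \<mu>) * real b powr (1 / q)"
  proof (rule lq_norm_interpolation[OF q])
    have "P + R \<le> C * (b * \<mu>)"
      using scaled(2) \<mu> b0 by (simp add: add_divide_distrib[symmetric] pos_divide_le_eq)
    then show "(\<Sum>j=1..p. \<bar>u j\<bar>) \<le> C * \<mu> * b" unfolding N by (simp add: mult_ac)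
    have "sqrt b * x \<le> C * (b * \<mu>)"
      using scaled(1) \<mu> b0 by (simp add: pos_divide_le_eq)
    also have "\<dots> = sqrt b * (C * \<mu> * sqrt b)" by simp
    finally have "x \<le> C * \<mu> * sqrt b" using b0 by simp
    then have "x\<^sup>2 \<le> (C * \<mu> * sqrt b)\<^sup>2" using nonneg by (intro power_mono) auto
    then show "(\<Sum>j=1..p. (u j)\<^sup>2) \<le> (C * \<mu>)\<^sup>2 * b"
      unfolding x_sq by (simp add: power_mult_distrib)
  qed (use C \<mu> b0 in auto)
  then show ?thesis
    unfolding wfun_def C_def[symmetric] by (simp add: u_def \<mu>_def mult_ac)
qed

section \<open>Regular noise vectors\<close>

text \<open>Completing the square turns the integrand into a multiple of a shifted normal density.\<close>

lemma nn_integral_exp_normal: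
  assumes \<sigma>: "0 < \<sigma>"
  shows "(\<integral>\<^sup>+x. exp (c * x) \<partial>density lborel (normal_density 0 \<sigma>)) = exp (\<sigma>\<^sup>2 / 2 * c\<^sup>2)"
proof -
  have "(\<integral>\<^sup>+x. exp (c * x) \<partial>density lborel (normal_density 0 \<sigma>))
      = (\<integral>\<^sup>+x. ennreal (normal_density 0 \<sigma> x * exp (c * x)) \<partial>lborel)"
    by (subst nn_integral_density) (auto simp: ennreal_mult')
  also have "\<dots> = (\<integral>\<^sup>+x. ennreal (exp (\<sigma>\<^sup>2 / 2 * c\<^sup>2)) * ennreal (normal_density (c * \<sigma>\<^sup>2) \<sigma> x) \<partial>lborel)"
  proof (rule nn_integral_cong)
    fix x
    have "- (x\<^sup>2 / (2 * \<sigma>\<^sup>2)) + c * x = \<sigma>\<^sup>2 / 2 * c\<^sup>2 + - ((x - c * \<sigma>\<^sup>2)\<^sup>2 / (2 * \<sigma>\<^sup>2))"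
      using \<sigma> by (simp add: field_simps power2_eq_square)
    then have "exp (- (x\<^sup>2 / (2 * \<sigma>\<^sup>2))) * exp (c * x)
        = exp (\<sigma>\<^sup>2 / 2 * c\<^sup>2) * exp (- ((x - c * \<sigma>\<^sup>2)\<^sup>2 / (2 * \<sigma>\<^sup>2)))"
      by (simp only: exp_add[symmetric])
    then have "normal_density 0 \<sigma> x * exp (c * x) = exp (\<sigma>\<^sup>2 / 2 * c\<^sup>2) * normal_density (c * \<sigma>\<^sup>2) \<sigma> x"
      by (simp add: normal_density_def mult_ac)
    then show "ennreal (normal_density 0 \<sigma> x * exp (c * x))
        = ennreal (exp (\<sigma>\<^sup>2 / 2 * c\<^sup>2)) * ennreal (normal_density (c * \<sigma>\<^sup>2) \<sigma> x)"
      by (simp add: ennreal_mult)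
  qed
  also have "\<dots> = exp (\<sigma>\<^sup>2 / 2 * c\<^sup>2) * (\<integral>\<^sup>+x. normal_density (c * \<sigma>\<^sup>2) \<sigma> x \<partial>lborel)"
    by (rule nn_integral_cmult) auto
  also have "(\<integral>\<^sup>+x. normal_density (c * \<sigma>\<^sup>2) \<sigma> x \<partial>lborel) = 1"
    using prob_space.emeasure_space_1[OF prob_space_normal_density[OF \<sigma>, of "c * \<sigma>\<^sup>2"]]
    by (simp add: emeasure_density)
  finally show ?thesis by simp
qed

lemma nn_integral_exp_gauss_noise:
  assumes \<sigma>: "0 < \<sigma>"
  shows "(\<integral>\<^sup>+\<xi>. exp (\<Sum>i=1..n. c i * \<xi> i) \<partial>gauss_noise n \<sigma>) = exp (\<sigma>\<^sup>2 / 2 * (\<Sum>i=1..n. (c i)\<^sup>2))"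
proof -
  interpret prob_space "density lborel (normal_density 0 \<sigma>)" by (rule prob_space_normal_density[OF \<sigma>])
  interpret product_sigma_finite "\<lambda>_::nat. density lborel (normal_density 0 \<sigma>)" by standard
  have "(\<integral>\<^sup>+\<xi>. exp (\<Sum>i=1..n. c i * \<xi> i) \<partial>gauss_noise n \<sigma>)
      = (\<integral>\<^sup>+\<xi>. (\<Prod>i\<in>{1..n}. ennreal (exp (c i * \<xi> i))) \<partial>gauss_noise n \<sigma>)"
    by (simp add: exp_sum prod_ennreal)
  also have "\<dots> = (\<Prod>i\<in>{1..n}. \<integral>\<^sup>+x. exp (c i * x) \<partial>density lborel (normal_density 0 \<sigma>))"
    unfolding gauss_noise_def by (rule product_nn_integral_prod) auto
  also have "\<dots> = exp (\<sigma>\<^sup>2 / 2 * (\<Sum>i=1..n. (c i)\<^sup>2))"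
    unfolding nn_integral_exp_normal[OF \<sigma>] by (simp add: prod_ennreal sum_distrib_left exp_sum)
  finally show ?thesis .
qed

lemma column_norm_sq:
  assumes "1 \<le> n" "j \<in> {1..p}" "norm_n n (mat_vec n p X (unit_vec p j)) \<le> 1"
  shows "(\<Sum>i=1..n. (X i j)\<^sup>2) \<le> n"
proof -
  have "mat_vec n p X (unit_vec p j) i = X i j" if "i \<in> {1..n}" for i
  proof -
    have "(\<Sum>k=1..p. X i k * unit_vec p j k) = (\<Sum>k=1..p. if k = j then X i j else 0)"
      by (intro sum.cong) (auto simp: unit_vec_def)
    then show ?thesis using assms that by (simp add: mat_vec_def)
  qed
  then have "norm_n n (mat_vec n p X (unit_vec p j)) = sqrt (1 / real n * (\<Sum>i=1..n. (X i j)\<^sup>2))"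
    unfolding norm_n_def by (intro arg_cong[where f = "\<lambda>S. sqrt (1 / real n * S)"] sum.cong) auto
  then show ?thesis using assms by (simp add: field_simps)
qed

text \<open>The square of the excess over \<open>\<tau>\<close> is dominated by exponentials, whose Gaussian means are explicit.\<close>

lemma excess_sq_le_exp:
  fixes z \<tau> t :: real
  assumes t: "0 < t"
  shows "(max 0 (\<bar>z\<bar> - \<tau>))\<^sup>2 \<le> 2 / t\<^sup>2 * exp (- (t * \<tau>)) * (exp (t * z) + exp (- (t * z)))"
proof (cases "\<tau> < \<bar>z\<bar>")
  case True
  let ?y = "t * (\<bar>z\<bar> - \<tau>)"
  define W where "W = exp (- (t * \<tau>)) * (exp (t * z) + exp (- (t * z)))"
  have "0 \<le> ?y" using True t by simp
  then have "?y\<^sup>2 / 2 \<le> exp ?y"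
    using exp_lower_Taylor_quadratic[of ?y] by linarith
  also have "\<dots> = exp (- (t * \<tau>)) * exp (t * \<bar>z\<bar>)" by (simp add: exp_add[symmetric] algebra_simps)
  also have "\<dots> \<le> W"
    unfolding W_def by (intro mult_left_mono) (auto simp: abs_if)
  finally have "(\<bar>z\<bar> - \<tau>)\<^sup>2 * t\<^sup>2 \<le> 2 * W" by (simp add: power_mult_distrib mult.commute)
  then have "(\<bar>z\<bar> - \<tau>)\<^sup>2 \<le> 2 * W / t\<^sup>2" using t by (subst pos_le_divide_eq) auto
  then show ?thesis using True by (simp add: W_def mult.assoc)
qed (auto intro!: mult_nonneg_nonneg)

text \<open>The noise vectors whose correlations with the columns of \<open>X\<close> behave as is typical at sparsity \<open>b\<close>: a few
  of them may be large, but the total squared excess over \<open>sqrt 2 \<mu>\<close> is at most \<open>b \<mu>\<^sup>2\<close>.\<close>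

definition regular_noise :: "nat \<Rightarrow> nat \<Rightarrow> (nat \<Rightarrow> nat \<Rightarrow> real) \<Rightarrow> real \<Rightarrow> real \<Rightarrow> (nat \<Rightarrow> real) set" where
  "regular_noise n p X b \<mu> = {\<xi> \<in> rvec n.
     (\<Sum>j=1..p. (max 0 (\<bar>(\<Sum>i=1..n. X i j * \<xi> i) / n\<bar> - sqrt 2 * \<mu>))\<^sup>2) \<le> b * \<mu>\<^sup>2}"

text \<open>A single correlation has variance at most \<open>\<sigma>\<^sup>2 / n\<close>, so its expected squared excess over the threshold
  is at most a multiple of \<open>exp (- L) \<sigma>\<^sup>2 / (n L)\<close> with \<open>L = ln (2 e p / b)\<close>. As \<open>p exp (- L) = b / (2 e)\<close>, the
  sum over the columns has a mean of order \<open>b \<sigma>\<^sup>2 / (n L)\<close>, whatever the dependence between them, and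
  \<open>\<mu>\<^sup>2 = \<sigma>\<^sup>2 L / n\<close>.\<close>

lemma regular_noise_prob:
  fixes n p b :: nat and \<sigma> \<mu> :: real
  defines "\<mu> \<equiv> \<sigma> * sqrt (ln (2 * exp 1 * real p / real b) / real n)"
  assumes n: "1 \<le> n" and \<sigma>: "0 < \<sigma>" and b: "1 \<le> b" "b \<le> p"
    and col: "\<forall>j\<in>{1..p}. norm_n n (mat_vec n p X (unit_vec p j)) \<le> 1"
  shows "regular_noise n p X b \<mu> \<in> sets (gauss_noise n \<sigma>)"
    and "1 / 2 \<le> measure (gauss_noise n \<sigma>) (regular_noise n p X b \<mu>)"
proof -
  let ?G = "gauss_noise n \<sigma>"
  interpret prob_space ?G by (rule prob_space_gauss_noise[OF \<sigma>])
  define z where "z j \<xi> = (\<Sum>i=1..n. X i j * \<xi> i) / n" for j and \<xi> :: "nat \<Rightarrow> real"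
  define Z where "Z \<xi> = (\<Sum>j=1..p. (max 0 (\<bar>z j \<xi>\<bar> - sqrt 2 * \<mu>))\<^sup>2)" for \<xi>
  have comp[measurable]: "(\<lambda>\<xi>. \<xi> i) \<in> borel_measurable ?G" if "i \<in> {1..n}" for i
    using that measurable_component_singleton[of i "{1..n}" "\<lambda>_. density lborel (normal_density 0 \<sigma>)"]
    by (simp add: gauss_noise_def)
  have z_meas[measurable]: "z j \<in> borel_measurable ?G" for j
    unfolding z_def[abs_def] by (intro borel_measurable_divide borel_measurable_sum borel_measurable_times comp) auto
  have Z_meas[measurable]: "Z \<in> borel_measurable ?G" unfolding Z_def[abs_def] by measurable
  have K: "regular_noise n p X b \<mu> = {\<xi> \<in> space ?G. Z \<xi> \<le> b * \<mu>\<^sup>2}"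
    by (simp add: regular_noise_def Z_def z_def space_gauss_noise)
  show meas: "regular_noise n p X b \<mu> \<in> sets ?G" unfolding K by measurable

  define L where "L = ln (2 * exp 1 * real p / real b)"
  have "exp 1 * 1 \<le> exp 1 * (2 * real p / real b)" using b by (intro mult_left_mono) (auto simp: field_simps)
  then have arg: "exp 1 \<le> 2 * exp 1 * real p / real b" by (simp add: mult_ac)
  then have L1: "1 \<le> L" using less_le_trans[OF exp_gt_zero arg] by (simp add: L_def ln_ge_iff)
  have exp_L: "exp (- L) = b / (2 * exp 1 * p)"
    using less_le_trans[OF exp_gt_zero arg] by (simp add: L_def exp_minus)
  have \<mu>: "0 < \<mu>" "\<mu>\<^sup>2 * n = \<sigma>\<^sup>2 * L"
    using n \<sigma> L1 by (auto simp: \<mu>_def L_def[symmetric] power_mult_distrib)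
  \<comment> \<open>the optimal Chernoff parameter\<close>
  define t where "t = sqrt 2 * \<mu> * n / \<sigma>\<^sup>2"
  have t: "0 < t" using \<mu> n \<sigma> by (simp add: t_def)
  have t_\<tau>: "t * (sqrt 2 * \<mu>) = 2 * L"
  proof -
    have "t * (sqrt 2 * \<mu>) = 2 * (\<mu>\<^sup>2 * n) / \<sigma>\<^sup>2" by (simp add: t_def power2_eq_square)
    then show ?thesis unfolding \<mu>(2) using \<sigma> by simp
  qed
  have t_sq: "t\<^sup>2 * \<sigma>\<^sup>2 = 2 * L * n"
  proof -
    have "t\<^sup>2 * \<sigma>\<^sup>2 = 2 * (\<mu>\<^sup>2 * n) * n / \<sigma>\<^sup>2"
      using \<sigma> by (simp add: t_def power2_eq_square)
    then show ?thesis unfolding \<mu>(2) using \<sigma> by simp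
  qed
  have mgf: "(\<integral>\<^sup>+\<xi>. exp (c * z j \<xi>) \<partial>?G) \<le> exp L" if j: "j \<in> {1..p}" and c: "c\<^sup>2 = t\<^sup>2" for j c
  proof -
    have "(\<integral>\<^sup>+\<xi>. exp (c * z j \<xi>) \<partial>?G) = (\<integral>\<^sup>+\<xi>. exp (\<Sum>i=1..n. (c * X i j / n) * \<xi> i) \<partial>?G)"
      by (simp add: z_def sum_distrib_left sum_divide_distrib mult_ac)
    also have "\<dots> = exp (\<sigma>\<^sup>2 / 2 * (\<Sum>i=1..n. (c * X i j / n)\<^sup>2))"
      by (rule nn_integral_exp_gauss_noise[OF \<sigma>])
    also have "\<dots> \<le> exp L"
    proof -
      have "\<sigma>\<^sup>2 / 2 * (\<Sum>i=1..n. (c * X i j / n)\<^sup>2) = (t\<^sup>2 * \<sigma>\<^sup>2) / (2 * (real n)\<^sup>2) * (\<Sum>i=1..n. (X i j)\<^sup>2)"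
        by (simp add: power_mult_distrib power_divide c sum_distrib_left sum_divide_distrib mult_ac)
      also have "\<dots> = L / n * (\<Sum>i=1..n. (X i j)\<^sup>2)"
        unfolding t_sq using n by (simp add: power2_eq_square)
      also have "\<dots> \<le> L / n * n"
        using column_norm_sq[OF n j] col j L1 by (intro mult_left_mono) auto
      finally show ?thesis using n by (intro ennreal_leI) simp
    qed
    finally show ?thesis .
  qed
  have mean: "(\<integral>\<^sup>+\<xi>. Z \<xi> \<partial>?G) \<le> ennreal (b * \<mu>\<^sup>2 / 2)"
  proof -
    define c where "c = 2 / t\<^sup>2 * exp (- (2 * L))"
    have c_nonneg: "0 \<le> c" by (simp add: c_def)
    have "(\<integral>\<^sup>+\<xi>. Z \<xi> \<partial>?G) \<le> (\<integral>\<^sup>+\<xi>. (\<Sum>j=1..p. ennreal c * (ennreal (exp (t * z j \<xi>)) + ennreal (exp (- t * z j \<xi>)))) \<partial>?G)"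
    proof (rule nn_integral_mono)
      fix \<xi>
      have "Z \<xi> \<le> (\<Sum>j=1..p. c * (exp (t * z j \<xi>) + exp (- t * z j \<xi>)))"
        unfolding Z_def using excess_sq_le_exp[OF t, of _ "sqrt 2 * \<mu>"] by (intro sum_mono) (simp add: c_def t_\<tau>)
      then have "ennreal (Z \<xi>) \<le> ennreal (\<Sum>j=1..p. c * (exp (t * z j \<xi>) + exp (- t * z j \<xi>)))"
        by (rule ennreal_leI)
      also have "\<dots> = (\<Sum>j=1..p. ennreal (c * (exp (t * z j \<xi>) + exp (- t * z j \<xi>))))"
        using c_nonneg by (intro sum_ennreal[symmetric]) simp
      also have "\<dots> = (\<Sum>j=1..p. ennreal c * (ennreal (exp (t * z j \<xi>)) + ennreal (exp (- t * z j \<xi>))))"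
        using c_nonneg by (simp add: ennreal_mult)
      finally show "ennreal (Z \<xi>) \<le> (\<Sum>j=1..p. ennreal c * (ennreal (exp (t * z j \<xi>)) + ennreal (exp (- t * z j \<xi>))))" .
    qed
    also have "\<dots> = (\<Sum>j=1..p. ennreal c * ((\<integral>\<^sup>+\<xi>. exp (t * z j \<xi>) \<partial>?G) + (\<integral>\<^sup>+\<xi>. exp (- t * z j \<xi>) \<partial>?G)))"
      by (simp add: nn_integral_sum nn_integral_cmult nn_integral_add)
    also have "\<dots> \<le> (\<Sum>j=1..p. ennreal c * (ennreal (exp L) + ennreal (exp L)))"
      by (intro sum_mono mult_left_mono add_mono mgf) auto
    also have "\<dots> = ennreal (p * (c * (exp L + exp L)))"
      using c_nonneg
      by (simp add: ennreal_of_nat_eq_real_of_nat ennreal_mult[symmetric] ennreal_plus[symmetric] del: ennreal_plus)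
    also have "\<dots> \<le> ennreal (b * \<mu>\<^sup>2 / 2)"
    proof (rule ennreal_leI)
      have "exp (- (2 * L)) * (exp L + exp L) = 2 * exp (- L)"
        by (simp add: exp_add[symmetric] distrib_left)
      then have "p * (c * (exp L + exp L)) = p * (4 / t\<^sup>2 * exp (- L))"
        unfolding c_def by simp
      also have "\<dots> = 2 / exp 1 * b / t\<^sup>2" using b by (simp add: exp_L field_simps)
      also have "\<dots> \<le> 1 * real b / t\<^sup>2"
      proof -
        have "2 / exp 1 \<le> (1::real)" using exp_ge_add_one_self[of 1] by (simp add: field_simps)
        then show ?thesis by (intro divide_right_mono mult_right_mono) auto
      qed
      also have "\<dots> = b * \<sigma>\<^sup>2 / (2 * L * n)" using \<sigma> t_sq[symmetric] by simp
      also have "\<dots> \<le> b * (\<sigma>\<^sup>2 * L / n) / 2"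
      proof -
        have "1 * 1 \<le> L * L" using L1 by (intro mult_mono) auto
        then have "b * \<sigma>\<^sup>2 / n / 2 * (1 / L) \<le> b * \<sigma>\<^sup>2 / n / 2 * L"
          using L1 by (intro mult_left_mono) (auto simp: field_simps)
        then show ?thesis by (simp add: mult_ac)
      qed
      also have "\<sigma>\<^sup>2 * L / n = \<mu>\<^sup>2" using \<mu>(2) n by (simp add: field_simps)
      finally show "p * (c * (exp L + exp L)) \<le> b * \<mu>\<^sup>2 / 2" .
    qed
    finally show ?thesis .
  qed
  have c0: "0 < b * \<mu>\<^sup>2" using b \<mu> by simp
  have "emeasure ?G (space ?G - regular_noise n p X b \<mu>)
      \<le> emeasure ?G {\<xi> \<in> space ?G. 1 \<le> ennreal (1 / (b * \<mu>\<^sup>2)) * ennreal (Z \<xi>)}"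
  proof (rule emeasure_mono)
    have "1 \<le> ennreal (1 / (b * \<mu>\<^sup>2)) * ennreal (Z \<xi>)" if "b * \<mu>\<^sup>2 < Z \<xi>" for \<xi>
    proof -
      have "1 \<le> 1 / (b * \<mu>\<^sup>2) * Z \<xi>" using that c0 by (simp add: field_simps)
      then have "ennreal 1 \<le> ennreal (1 / (b * \<mu>\<^sup>2) * Z \<xi>)" by (rule ennreal_leI)
      also have "\<dots> = ennreal (1 / (b * \<mu>\<^sup>2)) * ennreal (Z \<xi>)"
        using c0 by (intro ennreal_mult') simp
      finally show ?thesis by (simp only: ennreal_1)
    qed
    then show "space ?G - regular_noise n p X b \<mu> \<subseteq> {\<xi> \<in> space ?G. 1 \<le> ennreal (1 / (b * \<mu>\<^sup>2)) * ennreal (Z \<xi>)}"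
      by (auto simp: K not_le)
  qed measurable
  also have "\<dots> \<le> ennreal (1 / (b * \<mu>\<^sup>2)) * (\<integral>\<^sup>+\<xi>. ennreal (Z \<xi>) * indicator (space ?G) \<xi> \<partial>?G)"
    by (rule nn_integral_Markov_inequality) measurable
  also have "(\<integral>\<^sup>+\<xi>. ennreal (Z \<xi>) * indicator (space ?G) \<xi> \<partial>?G) = (\<integral>\<^sup>+\<xi>. Z \<xi> \<partial>?G)"
    by (intro nn_integral_cong) simp
  also have "ennreal (1 / (b * \<mu>\<^sup>2)) * (\<integral>\<^sup>+\<xi>. Z \<xi> \<partial>?G) \<le> ennreal (1 / (b * \<mu>\<^sup>2)) * ennreal (b * \<mu>\<^sup>2 / 2)"
    using mean by (rule mult_left_mono) simp
  also have "\<dots> = ennreal (1 / 2)" using b \<mu> by (simp add: ennreal_mult[symmetric])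
  finally have "prob (space ?G - regular_noise n p X b \<mu>) \<le> 1 / 2"
    unfolding emeasure_eq_measure by (subst (asm) ennreal_le_iff) auto
  then show "1 / 2 \<le> prob (regular_noise n p X b \<mu>)"
    using prob_compl[OF meas] by simp
qed

section \<open>Deviation of a single Lasso estimator\<close>

text \<open>Up to its maximum at \<open>c / e\<close>, the function \<open>x ln (c / x)\<close> increases.\<close>

lemma mult_ln_mono:
  fixes x y c :: real
  assumes x: "0 < x" "x \<le> y" and c: "exp 1 * y \<le> c"
  shows "x * ln (c / x) \<le> y * ln (c / y)"
proof -
  have c0: "0 < c" using less_le_trans[OF mult_pos_pos[OF exp_gt_zero, of y] c] x by simp
  have "1 \<le> ln (c / y)" using x c c0 by (subst ln_ge_iff) (auto simp: field_simps)
  have "ln (c / x) = ln (c / y) + ln (y / x)"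
    using x c0 by (simp add: ln_div)
  also have "ln (y / x) \<le> y / x - 1" using x by (intro ln_le_minus_one) auto
  finally have "x * ln (c / x) \<le> x * (ln (c / y) + (y / x - 1))"
    using x by (intro mult_left_mono) auto
  also have "\<dots> = x * ln (c / y) + (y - x) * 1" using x by (simp add: field_simps)
  also have "\<dots> \<le> x * ln (c / y) + (y - x) * ln (c / y)"
    using x \<open>1 \<le> ln (c / y)\<close> by (intro add_left_mono mult_left_mono) auto
  finally show ?thesis by (simp add: algebra_simps)
qed

lemma measurable_lasso_error:
  assumes [measurable]: "est \<in> borel_vec n \<rightarrow>\<^sub>M borel_vec p"
  shows "(\<lambda>y. lq_norm p q (vsub p (est y) \<beta>)) \<in> borel_measurable (borel_vec n)"
proof -
  have comp: "(\<lambda>y. est y j) \<in> borel_measurable (borel_vec n)" if "j \<in> {1..p}" for j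
    using measurable_compose[OF assms, of "\<lambda>y. y j" borel] that
    by (auto simp: borel_vec_def)
  have "(\<lambda>y. \<Sum>j=1..p. \<bar>vsub p (est y) \<beta> j\<bar> powr q) \<in> borel_measurable (borel_vec n)"
  proof (rule borel_measurable_sum)
    fix j assume j: "j \<in> {1..p}"
    note [measurable] = comp[OF j]
    show "(\<lambda>y. \<bar>vsub p (est y) \<beta> j\<bar> powr q) \<in> borel_measurable (borel_vec n)"
      using j by (simp add: vsub_def)
  qed
  then show ?thesis unfolding lq_norm_def by measurable
qed

lemma measurable_observation:
  "(\<lambda>\<xi>. \<lambda>i\<in>{1..n}. m i + \<xi> i) \<in> gauss_noise n \<sigma> \<rightarrow>\<^sub>M borel_vec n"
proof -
  have "(\<lambda>\<xi>. m i + \<xi> i) \<in> borel_measurable (gauss_noise n \<sigma>)" if "i \<in> {1..n}" for i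
    using that measurable_component_singleton[of i "{1..n}" "\<lambda>_. density lborel (normal_density 0 \<sigma>)"]
    by (intro borel_measurable_add) (auto simp: gauss_noise_def)
  then show ?thesis unfolding borel_vec_def by (intro measurable_restrict) auto
qed

text \<open>If the error is larger than \<open>w(b)\<close>, then the noise has at least the squared distance
  \<open>8 \<sigma>\<^sup>2 s ln (p / (2 s))\<close> from all regular noise vectors. The hypothesis \<open>s \<le> 2 b\<close> makes this radius small
  enough for the deterministic bound.\<close>

lemma lasso_deviation:
  fixes n p s sstar b :: nat and \<sigma> q :: real and X :: "nat \<Rightarrow> nat \<Rightarrow> real"
  defines "\<theta> \<equiv> theta n p X (2 * sstar) 7"
  assumes n: "1 \<le> n" and p: "1 \<le> p" and \<sigma>: "0 < \<sigma>"
    and col: "\<forall>j\<in>{1..p}. norm_n n (mat_vec n p X (unit_vec p j)) \<le> 1"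
    and \<theta>: "0 < \<theta>" and q: "1 \<le> q" "q \<le> 2"
    and sstar: "real sstar \<le> real p / (2 * exp 1)"
    and b: "1 \<le> b" "b \<le> sstar" and s: "1 \<le> s" "s \<le> sstar" "s \<le> 2 * b"
    and est: "lasso_estimator n p X (lambda n p \<sigma> b) est" and \<beta>: "\<beta> \<in> B0 p s"
  defines "A \<equiv> {y \<in> rvec n. wfun n p \<sigma> q (49 * (4 + sqrt 2) / (4 * \<theta>\<^sup>2)) (real b) < lq_norm p q (vsub p (est y) \<beta>)}"
  shows "A \<in> sets (borel_vec n)"
    and "measure (obs_law n p \<sigma> X \<beta>) A \<le> 2 * (2 * real s / real p) ^ (2 * s)"
proof -
  let ?G = "gauss_noise n \<sigma>"
  interpret prob_space ?G by (rule prob_space_gauss_noise[OF \<sigma>])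
  have sp: "space (borel_vec n) = rvec n" by (simp add: borel_vec_def rvec_def space_PiM)
  have [measurable]: "(\<lambda>y. lq_norm p q (vsub p (est y) \<beta>)) \<in> borel_measurable (borel_vec n)"
    using est by (intro measurable_lasso_error) (simp add: lasso_estimator_def)
  show A: "A \<in> sets (borel_vec n)" unfolding A_def sp[symmetric] by measurable
  define obs where "obs \<xi> = (\<lambda>i\<in>{1..n}. mat_vec n p X \<beta> i + \<xi> i)" for \<xi>
  have obs: "obs \<in> ?G \<rightarrow>\<^sub>M borel_vec n" unfolding obs_def[abs_def] by (rule measurable_observation)
  define E where "E = obs -` A \<inter> space ?G"
  have E: "E \<in> sets ?G" unfolding E_def using obs A by (rule measurable_sets)
  have law: "measure (obs_law n p \<sigma> X \<beta>) A = prob E"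
    unfolding obs_law_def E_def obs_def[symmetric] using obs A by (rule measure_distr)

  have e2: "2 \<le> exp (1::real)" using exp_ge_add_one_self[of 1] by simp
  have p_ge: "2 * exp 1 * real sstar \<le> p" using sstar by (simp add: field_simps)
  have sstar_p: "real sstar \<le> p"
    using mult_right_mono[of 1 "2 * exp 1" "real sstar"] p_ge e2 by simp
  have bp: "b \<le> p" using b sstar_p by simp
  have p0: "0 < real p" "0 < real s" "0 < real b" using p s b by auto
  define L where "L = ln (2 * exp 1 * real p / real b)"
  define \<mu> where "\<mu> = \<sigma> * sqrt (ln (2 * exp 1 * real p / real b) / real n)"
  have c_le: "exp 1 * y \<le> 2 * exp 1 * real p" if "y \<le> real p" for y
    using that p0 by simp
  have L0: "0 \<le> L"
  proof -
    have "1 * real b \<le> exp 1 * real b" using e2 by (intro mult_right_mono) auto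
    also have "\<dots> \<le> 2 * exp 1 * real p" using b sstar_p by (intro c_le) simp
    finally show ?thesis using p0 by (simp add: L_def)
  qed
  define r where "r = 8 * \<sigma>\<^sup>2 * (s * ln (p / (2 * s)))"
  have s_ln: "s * ln (p / (2 * s)) \<le> 2 * b * L"
  proof -
    have "s * ln (p / (2 * s)) \<le> s * ln (2 * exp 1 * p / s)"
    proof (intro mult_left_mono)
      have "1 * (real p / (2 * s)) \<le> (4 * exp 1) * (real p / (2 * s))"
        using e2 by (intro mult_right_mono) auto
      then show "ln (p / (2 * s)) \<le> ln (2 * exp 1 * p / s)"
        using p0 by (intro ln_mono) (auto simp: mult_ac)
    qed auto
    also have "\<dots> \<le> 2 * b * L"
    proof (cases "s \<le> b")
      case True
      have "s * ln (2 * exp 1 * p / s) \<le> b * L"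
        unfolding L_def using True p0 b sstar_p by (intro mult_ln_mono c_le) auto
      also have "\<dots> \<le> 2 * b * L" using L0 p0 by (intro mult_right_mono) auto
      finally show ?thesis .
    next
      case False
      then have "ln (2 * exp 1 * p / s) \<le> L"
        unfolding L_def using p0 by (intro ln_mono divide_left_mono) auto
      then have "s * ln (2 * exp 1 * p / s) \<le> s * L" by (intro mult_left_mono) auto
      also have "\<dots> \<le> 2 * b * L" using s L0 by (intro mult_right_mono) auto
      finally show ?thesis .
    qed
    finally show ?thesis .
  qed
  have \<mu>_sq: "\<mu>\<^sup>2 = \<sigma>\<^sup>2 * L / n"
    unfolding \<mu>_def L_def[symmetric] using L0 by (simp add: power_mult_distrib)
  have far: "r \<le> (\<Sum>i=1..n. (\<xi> i - a i)\<^sup>2)" if \<xi>: "\<xi> \<in> E" and a: "a \<in> regular_noise n p X b \<mu>" for \<xi> a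
  proof (rule ccontr)
    assume "\<not> ?thesis"
    then have "(\<Sum>i=1..n. (\<xi> i - a i)\<^sup>2) / n \<le> r / n" by (intro divide_right_mono) auto
    also have "\<dots> \<le> 8 * \<sigma>\<^sup>2 * (2 * b * L) / n"
      unfolding r_def using s_ln by (intro divide_right_mono mult_left_mono) auto
    also have "\<dots> = 16 * b * \<mu>\<^sup>2" by (simp add: \<mu>_sq)
    finally have close: "(\<Sum>i=1..n. (\<xi> i - a i)\<^sup>2) / n \<le> 16 * b * \<mu>\<^sup>2" .
    have "obs \<xi> \<in> A" using \<xi> by (simp add: E_def)
    then have min: "is_arg_min (lasso_objective n p X (lambda n p \<sigma> b) (obs \<xi>)) (\<lambda>\<beta>. \<beta> \<in> rvec p) (est (obs \<xi>))"
      using est by (simp add: A_def lasso_estimator_def)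
    have "lq_norm p q (vsub p (est (obs \<xi>)) \<beta>) \<le> wfun n p \<sigma> q (49 * (4 + sqrt 2) / (4 * \<theta>\<^sup>2)) (real b)"
      unfolding \<theta>_def
      by (rule lasso_error_bound[OF n p \<sigma> col \<theta>[unfolded \<theta>_def] b(1,2) bp q \<beta> s(3) min[unfolded obs_def],
            where a = a, folded obs_def \<mu>_def])
        (use a close in \<open>auto simp: regular_noise_def\<close>)
    then show False using \<open>obs \<xi> \<in> A\<close> by (simp add: A_def)
  qed
  note K = regular_noise_prob[OF n \<sigma> b(1) bp col, folded \<mu>_def]
  have "prob E * (1 / 2) \<le> prob E * prob (regular_noise n p X b \<mu>)"
    using K(2) by (intro mult_left_mono) auto
  also have "\<dots> \<le> exp (- (r / (4 * \<sigma>\<^sup>2)))"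
    using far by (intro gaussian_separated_sets[OF \<sigma> E K(1)])
  also have "\<dots> = (2 * real s / real p) ^ (2 * s)"
  proof -
    have "- (r / (4 * \<sigma>\<^sup>2)) = real (2 * s) * ln (2 * s / p)"
    proof -
      have "r / (4 * \<sigma>\<^sup>2) = 2 * (s * ln (p / (2 * s)))" using \<sigma> by (simp add: r_def)
      moreover have "ln (p / (2 * s)) = - ln (2 * s / p)" using p0 by (simp add: ln_div)
      ultimately show ?thesis by simp
    qed
    then show ?thesis using p0 by (simp only: exp_of_nat_mult) simp
  qed
  finally show "measure (obs_law n p \<sigma> X \<beta>) A \<le> 2 * (2 * real s / real p) ^ (2 * s)"
    unfolding law by simp
qed

section \<open>Selection of the sparsity level\<close>

lemma bseq_double: "1 \<le> k \<Longrightarrow> bseq (Suc k) = 2 * bseq k"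
  by (cases k) (auto simp: bseq_def)

lemma bseq_ge_1: "1 \<le> bseq k" by (simp add: bseq_def)

lemma Mmax_iff:
  assumes "1 \<le> sstar" "1 \<le> m"
  shows "m \<le> Mmax sstar \<longleftrightarrow> bseq m \<le> sstar"
proof -
  let ?S = "{m. 1 \<le> m \<and> bseq m \<le> sstar}"
  have "m \<le> sstar" if "m \<in> ?S" for m
  proof -
    have "m - 1 < bseq m" by (simp add: bseq_def)
    then show ?thesis using that by auto
  qed
  then have fin: "finite ?S" by (intro finite_subset[of ?S "{..sstar}"]) auto
  moreover have "1 \<in> ?S" using assms by (simp add: bseq_def)
  ultimately have "Mmax sstar \<in> ?S" unfolding Mmax_def by (intro Max_in) auto
  moreover have "bseq m \<le> bseq (Mmax sstar)" if "m \<le> Mmax sstar"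
    using that by (simp add: bseq_def power_increasing)
  moreover have "m \<le> Mmax sstar" if "bseq m \<le> sstar"
    unfolding Mmax_def using that assms fin by (intro Max_ge) auto
  ultimately show ?thesis by auto
qed

text \<open>If all estimators from \<open>m0\<close> on are accurate, consecutive ones among them are close to each other, so the
  selected index is at most \<open>m0 + 1\<close> (or \<open>M\<close>). From the selected index up to this one, consecutive
  estimators differ by at most \<open>2 W\<close> by the very definition of the selection, and a geometric sum with
  ratio \<open>4/5\<close> is at most five times its last term.\<close>

lemma lepski_selection_error:
  fixes n p sstar m0 :: nat and \<sigma> q C0 :: real
  defines "W \<equiv> \<lambda>k. wfun n p \<sigma> q C0 (real (bseq k))"
    and "M \<equiv> Mmax sstar"
  assumes q: "1 \<le> q" and m0: "2 \<le> m0" "m0 \<le> M"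
    and W_nonneg: "\<And>k. 1 \<le> k \<Longrightarrow> k \<le> M \<Longrightarrow> 0 \<le> W k"
    and ratio: "\<And>k. 1 \<le> k \<Longrightarrow> k < M \<Longrightarrow> W k \<le> 4 / 5 * W (Suc k)"
    and good: "\<And>k. m0 \<le> k \<Longrightarrow> k \<le> M \<Longrightarrow> lq_norm p q (vsub p (bhat (bseq k) y) \<beta>) \<le> W k"
  shows "lq_norm p q (vsub p (beta_tilde n p \<sigma> q C0 sstar bhat y) \<beta>) \<le> 11 * W (min (Suc m0) M)"
proof -
  define g where "g k = bhat (bseq k) y" for k
  define d where "d a b = lq_norm p q (vsub p a b)" for a b
  have tri: "d a c \<le> d a b + d b c" for a b c
    unfolding d_def by (rule lq_norm_vsub_triangle[OF q])
  have sym: "d a b = d b a" for a b unfolding d_def by (rule lq_norm_vsub_commute)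
  define S where "S = {m \<in> {2..M}. \<forall>k\<in>{m..M}. d (g k) (g (k - 1)) \<le> 2 * W k}"
  define mh where "mh = m_hat n p \<sigma> q C0 sstar bhat y"
  define m1 where "m1 = min (Suc m0) M"
  have mh: "mh = (if S = {} then M else Min S)"
    unfolding mh_def m_hat_def S_def M_def W_def d_def g_def Let_def by (rule refl)
  have fin: "finite S" by (simp add: S_def)
  have in_S: "Suc m0 \<in> S" if "Suc m0 \<le> M"
  proof -
    have "d (g k) (g (k - 1)) \<le> 2 * W k" if k: "Suc m0 \<le> k" "k \<le> M" for k
    proof -
      have "d (g k) (g (k - 1)) \<le> d (g k) \<beta> + d (g (k - 1)) \<beta>"
        using tri[of "g k" "g (k - 1)" \<beta>] sym[of \<beta> "g (k - 1)"] by simp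
      also have "\<dots> \<le> W k + W (k - 1)"
        using good[of k] good[of "k - 1"] k by (intro add_mono) (auto simp: d_def g_def)
      also have "W (k - 1) \<le> W k"
      proof -
        have "1 \<le> k - 1" "k - 1 < M" "Suc (k - 1) = k" using k m0 by auto
        then show ?thesis using ratio[of "k - 1"] W_nonneg[of k] k by simp
      qed
      finally show ?thesis by simp
    qed
    then show ?thesis using that m0 by (auto simp: S_def)
  qed
  have mh_range: "2 \<le> mh \<and> mh \<le> m1 \<and> (\<forall>k. mh < k \<and> k \<le> M \<longrightarrow> d (g k) (g (k - 1)) \<le> 2 * W k)"
  proof (cases "S = {}")
    case True
    then show ?thesis using mh in_S m0 by (auto simp: m1_def min_def)
  next
    case False
    then have "mh \<in> S" using mh fin by simp
    moreover have "mh \<le> Suc m0" if "Suc m0 \<le> M" using mh False fin in_S[OF that] by simp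
    ultimately show ?thesis using m0 by (auto simp: S_def m1_def min_def)
  qed
  have chain: "d (g mh) (g m) \<le> 10 * W m" if "mh \<le> m" "m \<le> m1" for m
    using that
  proof (induction m rule: dec_induct)
    case base
    have "vsub p (g mh) (g mh) j = 0" if "j \<in> {1..p}" for j using that by (simp add: vsub_def)
    then have "d (g mh) (g mh) = 0" using q by (simp add: d_def lq_norm_eq_0_iff)
    then show ?case using W_nonneg[of mh] mh_range by (simp add: m1_def)
  next
    case (step m)
    have m: "1 \<le> m" "m < M" using step mh_range by (auto simp: m1_def)
    have "d (g mh) (g (Suc m)) \<le> d (g mh) (g m) + d (g m) (g (Suc m))" by (rule tri)
    also have "\<dots> \<le> 10 * W m + 2 * W (Suc m)"
    proof (rule add_mono)
      show "d (g mh) (g m) \<le> 10 * W m" using step by simp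
      have "d (g (Suc m)) (g (Suc m - 1)) \<le> 2 * W (Suc m)"
        using mh_range step m by (intro mh_range[THEN conjunct2, THEN conjunct2, rule_format]) auto
      then show "d (g m) (g (Suc m)) \<le> 2 * W (Suc m)" by (simp add: sym)
    qed
    also have "\<dots> \<le> 10 * W (Suc m)" using ratio[OF m] by simp
    finally show ?case .
  qed
  have "Suc (mh - 1) = mh" "1 \<le> mh - 1" using mh_range by auto
  then have "beta_tilde n p \<sigma> q C0 sstar bhat y = g mh"
    using bseq_double[of "mh - 1"] by (simp add: beta_tilde_def s_hat_def mh_def[symmetric] g_def)
  then have "lq_norm p q (vsub p (beta_tilde n p \<sigma> q C0 sstar bhat y) \<beta>) = d (g mh) \<beta>"
    by (simp add: d_def)
  also have "\<dots> \<le> d (g mh) (g m1) + d (g m1) \<beta>" by (rule tri)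
  also have "\<dots> \<le> 10 * W m1 + W m1"
    using chain[of m1] good[of m1] mh_range m0 by (intro add_mono) (auto simp: m1_def d_def g_def)
  finally show ?thesis by (simp add: m1_def)
qed

text \<open>Doubling \<open>b\<close> gains a factor of at least \<open>sqrt 2\<close> from the power, as \<open>q \<le> 2\<close>, and loses at most
  \<open>sqrt (32/25)\<close> from the logarithm because \<open>2 b\<close> is at most \<open>p / (2 e)\<close>.\<close>

lemma wfun_double:
  fixes b :: real
  assumes q: "1 \<le> q" "q \<le> 2" and C: "0 \<le> C0" "0 \<le> \<sigma>" and b: "1 \<le> b" "2 * exp 1 * (2 * b) \<le> real p"
  shows "wfun n p \<sigma> q C0 b \<le> 4 / 5 * wfun n p \<sigma> q C0 (2 * b)"
proof -
  let ?L = "\<lambda>x. ln (2 * exp 1 * real p / x)"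
  have pos: "0 < real p" using less_le_trans[OF _ b(2), of 0] b by simp
  have "exp 1 * (4 * exp 1) \<le> 2 * exp 1 * real p / (2 * b)"
    using b pos by (simp add: field_simps)
  then have "ln (exp 1 * (4 * exp 1)) \<le> ?L (2 * b)" by (intro ln_mono) auto
  also have "ln (exp 1 * (4 * exp 1)) = 2 + ln (2 * 2 :: real)" by (simp add: ln_mult)
  also have "\<dots> = 2 + 2 * ln 2" by (subst ln_mult) auto
  finally have L2: "2 + 2 * ln 2 \<le> ?L (2 * b)" .
  have ln2: "ln 2 \<le> (1::real)" using ln_le_minus_one[of 2] by simp
  have "?L b = ?L (2 * b) + ln 2"
    using pos b by (simp add: ln_div ln_mult)
  then have "?L b \<le> 16 / 25 * 2 * ?L (2 * b)" using L2 ln2 by linarith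
  then have "?L b / n \<le> 16 / 25 * 2 * ?L (2 * b) / n" by (rule divide_right_mono) simp
  also have "\<dots> = (4 / 5)\<^sup>2 * (2 * (?L (2 * b) / n))" by (simp add: power2_eq_square)
  finally have "sqrt (?L b / n) \<le> sqrt ((4 / 5)\<^sup>2 * (2 * (?L (2 * b) / n)))" by (rule real_sqrt_le_mono)
  also have "\<dots> = 4 / 5 * (sqrt 2 * sqrt (?L (2 * b) / n))"
    by (simp only: real_sqrt_mult) simp
  also have "\<dots> \<le> 4 / 5 * (2 powr (1 / q) * sqrt (?L (2 * b) / n))"
  proof (intro mult_left_mono mult_right_mono)
    have "2 powr (1 / 2) \<le> 2 powr (1 / q)" using q by (intro powr_mono) (auto simp: field_simps)
    then show "sqrt 2 \<le> 2 powr (1 / q)" by (simp add: powr_half_sqrt)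
    have "0 \<le> ?L (2 * b)" using L2 ln_gt_zero[of "2::real"] by linarith
    then show "0 \<le> sqrt (?L (2 * b) / n)" by simp
  qed auto
  finally have "C0 * \<sigma> * b powr (1 / q) * sqrt (?L b / n)
      \<le> C0 * \<sigma> * b powr (1 / q) * (4 / 5 * (2 powr (1 / q) * sqrt (?L (2 * b) / n)))"
    using C by (intro mult_left_mono) auto
  then show ?thesis using b by (simp add: wfun_def powr_mult mult_ac)
qed

lemma wfun_comparable:
  fixes b s :: real
  assumes q: "1 \<le> q" and C: "0 \<le> C0" "0 \<le> \<sigma>"
    and b: "0 < b" "s \<le> 2 * b" "b \<le> 4 * s" and s: "0 < s" "s \<le> real p"
  shows "wfun n p \<sigma> q C0 b \<le> 8 * wfun n p \<sigma> q C0 s"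
proof -
  let ?L = "\<lambda>x. ln (2 * exp 1 * real p / x)"
  have pos: "0 < real p" using s by simp
  have ln2: "ln 2 \<le> (1::real)" using ln_le_minus_one[of 2] by simp
  have "exp 1 * 1 \<le> exp 1 * (2 * real p / s)" using s by (intro mult_left_mono) (auto simp: field_simps)
  then have "exp 1 \<le> 2 * exp 1 * real p / s" by (simp add: mult_ac)
  then have Ls: "1 \<le> ?L s" using less_le_trans[OF exp_gt_zero] by (subst ln_ge_iff) auto
  have "?L b \<le> ln (2 * (2 * exp 1 * real p / s))"
    using b s pos by (intro ln_mono) (auto simp: field_simps)
  also have "\<dots> = ln 2 + ?L s" using s pos by (subst ln_mult) auto
  also have "\<dots> \<le> 4 * ?L s" using Ls ln2 by simp
  finally have "?L b / n \<le> 2\<^sup>2 * (?L s / n)" by (simp add: divide_right_mono)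
  then have "sqrt (?L b / n) \<le> sqrt (2\<^sup>2 * (?L s / n))" by (rule real_sqrt_le_mono)
  also have "\<dots> = 2 * sqrt (?L s / n)" by (simp only: real_sqrt_mult) simp
  finally have sq: "sqrt (?L b / n) \<le> 2 * sqrt (?L s / n)" .
  have "b powr (1 / q) \<le> (4 * s) powr (1 / q)" using b q by (intro powr_mono2) auto
  also have "\<dots> = 4 powr (1 / q) * s powr (1 / q)" using s by (simp add: powr_mult)
  also have "\<dots> \<le> 4 powr 1 * s powr (1 / q)" using q by (intro mult_right_mono powr_mono) auto
  finally have pw: "b powr (1 / q) \<le> 4 * s powr (1 / q)" by simp
  have "b powr (1 / q) * sqrt (?L b / n) \<le> 4 * s powr (1 / q) * (2 * sqrt (?L s / n))"
  proof -
    have "b powr (1 / q) * sqrt (?L b / n) \<le> b powr (1 / q) * (2 * sqrt (?L s / n))"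
      using sq by (rule mult_left_mono) simp
    also have "\<dots> \<le> 4 * s powr (1 / q) * (2 * sqrt (?L s / n))"
      using pw Ls by (intro mult_right_mono) auto
    finally show ?thesis .
  qed
  then have "C0 * \<sigma> * (b powr (1 / q) * sqrt (?L b / n)) \<le> C0 * \<sigma> * (4 * s powr (1 / q) * (2 * sqrt (?L s / n)))"
    using C by (intro mult_left_mono) auto
  then show ?thesis by (simp add: wfun_def mult_ac)
qed

section \<open>The adaptive estimator\<close>

text \<open>The constant is \<open>89 > 11 * 8\<close>, where \<open>11\<close> is the loss of the selection and \<open>8\<close> that of replacing \<open>s\<close> by a
  neighbouring value of the grid.\<close>

lemma lasso_adaptive_error_prob:
  fixes n p s sstar :: nat and \<sigma> q C0 :: real and X :: "nat \<Rightarrow> nat \<Rightarrow> real"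
  assumes n: "1 \<le> n" and p: "1 \<le> p" and \<sigma>: "0 < \<sigma>"
    and col: "\<forall>j\<in>{1..p}. norm_n n (mat_vec n p X (unit_vec p j)) \<le> 1"
    and sstar: "2 \<le> sstar" "sstar \<le> p" "real sstar \<le> real p / (2 * exp 1)"
    and \<theta>: "0 < theta n p X (2 * sstar) 7" and q: "1 \<le> q" "q \<le> 2"
    and C0: "C0 = 49 * (4 + sqrt 2) / (4 * (theta n p X (2 * sstar) 7)\<^sup>2)"
    and est: "\<And>k. 1 \<le> k \<Longrightarrow> k \<le> p \<Longrightarrow> lasso_estimator n p X (lambda n p \<sigma> k) (bhat k)"
    and s: "1 \<le> s" "s \<le> sstar" and \<beta>: "\<beta> \<in> B0 p s"
  shows "measure (obs_law n p \<sigma> X \<beta>)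
      {y \<in> rvec n. 89 * wfun n p \<sigma> q C0 (real s) \<le> lq_norm p q (vsub p (beta_tilde n p \<sigma> q C0 sstar bhat y) \<beta>)}
    \<le> (2 * (log 2 (real p))\<^sup>2 + 1) * (2 * real s / real p) ^ (2 * s)"
proof -
  define M where "M = Mmax sstar"
  define W where "W k = wfun n p \<sigma> q C0 (real (bseq k))" for k
  define A where "A k = {y \<in> rvec n. W k < lq_norm p q (vsub p (bhat (bseq k) y) \<beta>)}" for k
  let ?P = "obs_law n p \<sigma> X \<beta>"
  let ?bad = "{y \<in> rvec n. 89 * wfun n p \<sigma> q C0 (real s) \<le> lq_norm p q (vsub p (beta_tilde n p \<sigma> q C0 sstar bhat y) \<beta>)}"
  have M_iff: "k \<le> M \<longleftrightarrow> bseq k \<le> sstar" if "1 \<le> k" for k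
    unfolding M_def using Mmax_iff[of sstar k] sstar that by simp
  have M2: "2 \<le> M" using M_iff[of 2] sstar by (simp add: bseq_def)
  have C0_pos: "0 < C0" using \<theta> unfolding C0 by (intro divide_pos_pos mult_pos_pos) (auto intro: add_pos_nonneg)
  have p_ge: "2 * exp 1 * real sstar \<le> real p" using sstar(3) by (simp add: field_simps)
  \<comment> \<open>the first index from which on every estimator on the grid is tuned to at least half the true sparsity\<close>
  define m0 where "m0 = (LEAST m. 2 \<le> m \<and> s \<le> 2 * bseq m)"
  have "s \<le> 2 * bseq M"
  proof -
    have "\<not> bseq (Suc M) \<le> sstar" using M_iff[of "Suc M"] by simp
    then show ?thesis using s bseq_double[of M] M2 by simp
  qed
  then have m0: "2 \<le> m0" "s \<le> 2 * bseq m0" "m0 \<le> M"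
    using LeastI[of "\<lambda>m. 2 \<le> m \<and> s \<le> 2 * bseq m" M] Least_le[of "\<lambda>m. 2 \<le> m \<and> s \<le> 2 * bseq m" M] M2
    unfolding m0_def by auto
  have m0_upper: "bseq m0 \<le> 2 * s"
  proof (cases "m0 = 2")
    case True
    then show ?thesis using s by (simp add: bseq_def)
  next
    case False
    then have m: "2 \<le> m0 - 1" "m0 - 1 < m0" "Suc (m0 - 1) = m0" using m0 by auto
    have "\<not> s \<le> 2 * bseq (m0 - 1)"
      using not_less_Least[of "m0 - 1" "\<lambda>m. 2 \<le> m \<and> s \<le> 2 * bseq m"] m unfolding m0_def[symmetric] by auto
    then show ?thesis using bseq_double[of "m0 - 1"] m by simp
  qed
  have bseq_mono: "bseq k \<le> bseq l" if "k \<le> l" for k l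
    using that by (simp add: bseq_def power_increasing)
  have ln_pos: "0 < ln (2 * exp 1 * real p / x)" if "0 < x" "x \<le> real p" for x
  proof -
    have "1 < exp 1 * (2 * real p / x)"
      using that one_less_exp_iff[of "1::real"] by (intro less_1_mult') (auto simp: field_simps)
    then show ?thesis by (simp add: mult_ac)
  qed
  have W_nonneg: "0 \<le> W k" if "1 \<le> k" "k \<le> M" for k
    using C0_pos \<sigma> ln_pos[of "real (bseq k)"] M_iff[of k] that sstar bseq_ge_1[of k]
    by (simp add: W_def wfun_def)
  have W_ratio: "W k \<le> 4 / 5 * W (Suc k)" if k: "1 \<le> k" "k < M" for k
  proof -
    have "2 * bseq k \<le> sstar" using M_iff[of "Suc k"] k bseq_double[OF k(1)] by simp
    then have "2 * real (bseq k) \<le> real sstar" by (metis of_nat_le_iff of_nat_mult of_nat_numeral)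
    then have "2 * exp 1 * (2 * real (bseq k)) \<le> 2 * exp 1 * real sstar"
      by (intro mult_left_mono) auto
    then have "2 * exp 1 * (2 * real (bseq k)) \<le> real p" using p_ge by linarith
    then show ?thesis
      using wfun_double[OF q, of C0 \<sigma> "real (bseq k)" p n] C0_pos \<sigma> bseq_ge_1[of k] bseq_double[OF k(1)]
      by (simp add: W_def)
  qed
  have dev: "A k \<in> sets (borel_vec n)" "measure ?P (A k) \<le> 2 * (2 * real s / real p) ^ (2 * s)"
    if k: "k \<in> {m0..M}" for k
  proof -
    have bk: "1 \<le> bseq k" "bseq k \<le> sstar" "s \<le> 2 * bseq k"
      using k M_iff[of k] m0 bseq_ge_1[of k] bseq_mono[of m0 k] by auto
    note lasso_deviation[OF n p \<sigma> col \<theta> q sstar(3) bk(1,2) s bk(3) est[of "bseq k"] \<beta>,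
        folded C0, folded W_def, folded A_def]
    then show "A k \<in> sets (borel_vec n)" "measure ?P (A k) \<le> 2 * (2 * real s / real p) ^ (2 * s)"
      using bk sstar by auto
  qed
  have subset: "?bad \<subseteq> (\<Union>k\<in>{m0..M}. A k)"
  proof (rule ccontr)
    assume "\<not> ?thesis"
    then obtain y where y: "y \<in> ?bad" "\<And>k. k \<in> {m0..M} \<Longrightarrow> y \<notin> A k" by blast
    define m1 where "m1 = min (Suc m0) M"
    have good: "lq_norm p q (vsub p (bhat (bseq k) y) \<beta>) \<le> W k" if "m0 \<le> k" "k \<le> M" for k
      using y(1) y(2)[of k] that by (auto simp: A_def not_less)
    have "lq_norm p q (vsub p (beta_tilde n p \<sigma> q C0 sstar bhat y) \<beta>) \<le> 11 * W m1"
      unfolding m1_def W_def M_def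
      by (rule lepski_selection_error[OF q(1) m0(1)])
        (use m0 W_nonneg W_ratio good in \<open>auto simp: W_def M_def\<close>)
    also have "11 * W m1 \<le> 11 * (8 * wfun n p \<sigma> q C0 (real s))"
    proof -
      have "bseq m1 \<le> bseq (Suc m0)" by (intro bseq_mono) (simp add: m1_def)
      then have "bseq m1 \<le> 4 * s" using bseq_double[of m0] m0 m0_upper by simp
      then have "real (bseq m1) \<le> 4 * real s" by (metis of_nat_le_iff of_nat_mult of_nat_numeral)
      moreover have "s \<le> 2 * bseq m1" using m0 bseq_mono[of m0 m1] by (simp add: m1_def)
      then have "real s \<le> 2 * real (bseq m1)" by (metis of_nat_le_iff of_nat_mult of_nat_numeral)
      ultimately have "W m1 \<le> 8 * wfun n p \<sigma> q C0 (real s)"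
        unfolding W_def using C0_pos \<sigma> s sstar bseq_ge_1[of m1] q
        by (intro wfun_comparable) auto
      then show ?thesis by simp
    qed
    also have "\<dots> < 89 * wfun n p \<sigma> q C0 (real s)"
      using C0_pos \<sigma> s sstar n ln_pos[of "real s"] by (simp add: wfun_def)
    finally show False using y(1) by simp
  qed
  have prob: "prob_space ?P"
    unfolding obs_law_def
    by (intro prob_space.prob_space_distr prob_space_gauss_noise \<sigma> measurable_observation)
  interpret P: prob_space ?P by (rule prob)
  have sets: "sets ?P = sets (borel_vec n)" by (simp add: obs_law_def)
  have card: "real (card {m0..M}) \<le> (log 2 (real p))\<^sup>2"
  proof -
    have "real (2 ^ (M - 1)) \<le> real p"
      using M_iff[of M] M2 sstar unfolding bseq_def of_nat_le_iff by simp
    then have "2 powr real (M - 1) \<le> real p" by (simp add: powr_realpow)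
    then have "real (M - 1) \<le> log 2 (real p)" using p by (simp add: le_log_iff)
    moreover have "card {m0..M} \<le> M - 1" using m0 by simp
    moreover have log1: "1 \<le> log 2 (real p)" using sstar by (simp add: le_log_iff)
    ultimately have "real (card {m0..M}) \<le> log 2 (real p) * 1" by linarith
    also have "\<dots> \<le> log 2 (real p) * log 2 (real p)" using log1 by (intro mult_left_mono) auto
    finally show ?thesis by (simp add: power2_eq_square)
  qed
  have "measure ?P ?bad \<le> measure ?P (\<Union>k\<in>{m0..M}. A k)"
    using subset dev(1) by (intro P.finite_measure_mono) (auto simp: sets)
  also have "\<dots> \<le> (\<Sum>k\<in>{m0..M}. measure ?P (A k))"
    using dev(1) by (intro P.finite_measure_subadditive_finite) (auto simp: sets)
  also have "\<dots> \<le> (\<Sum>k\<in>{m0..M}. 2 * (2 * real s / real p) ^ (2 * s))"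
    by (intro sum_mono dev(2))
  also have "\<dots> = (2 * real (card {m0..M})) * (2 * real s / real p) ^ (2 * s)"
    by simp
  also have "\<dots> \<le> (2 * (log 2 (real p))\<^sup>2 + 1) * (2 * real s / real p) ^ (2 * s)"
    using card by (intro mult_right_mono) auto
  finally show ?thesis .
qed

theorem theorem5p2:
  "\<exists>C1::real. C1 > 0 \<and>
    (\<forall>(n::nat) (p::nat) (\<sigma>::real) (X::nat \<Rightarrow> nat \<Rightarrow> real) (sstar::nat) (q::real) (C0::real)
       (bhat :: nat \<Rightarrow> (nat \<Rightarrow> real) \<Rightarrow> nat \<Rightarrow> real).
       n \<ge> 1 \<longrightarrow> p \<ge> 1 \<longrightarrow> \<sigma> > 0 \<longrightarrow>
       (\<forall>j\<in>{1..p}. norm_n n (mat_vec n p X (unit_vec p j)) \<le> 1) \<longrightarrow>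
       sstar \<in> {2..p} \<longrightarrow>
       theta n p X (2 * sstar) 7 > 0 \<longrightarrow>
       real sstar \<le> real p / (2 * exp 1) \<longrightarrow>
       1 \<le> q \<longrightarrow> q \<le> 2 \<longrightarrow>
       C0 = 49 * (4 + sqrt 2) / (4 * (theta n p X (2 * sstar) 7)\<^sup>2) \<longrightarrow>
       (\<forall>s\<in>{1..p}. lasso_estimator n p X (lambda n p \<sigma> s) (bhat s)) \<longrightarrow>
       (\<forall>s\<in>{1..sstar}.
          (SUP \<beta>\<in>B0 p s. measure (obs_law n p \<sigma> X \<beta>)
             {y \<in> rvec n. lq_norm p q (vsub p (beta_tilde n p \<sigma> q C0 sstar bhat y) \<beta>)
                \<ge> C1 * C0 * \<sigma> * real s powr (1 / q)
                    * sqrt (ln (2 * exp 1 * real p / real s) / real n)})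
          \<le> (2 * (log 2 (real p))\<^sup>2 + 1) * (2 * real s / real p) ^ (2 * s)))"
proof (intro exI[of _ 89] conjI allI impI ballI)
  fix n p :: nat and \<sigma> :: real and X :: "nat \<Rightarrow> nat \<Rightarrow> real" and sstar :: nat and q C0 :: real
    and bhat :: "nat \<Rightarrow> (nat \<Rightarrow> real) \<Rightarrow> nat \<Rightarrow> real" and s :: nat
  assume n: "n \<ge> 1" and p: "p \<ge> 1" and \<sigma>: "\<sigma> > 0"
    and col: "\<forall>j\<in>{1..p}. norm_n n (mat_vec n p X (unit_vec p j)) \<le> 1"
    and sstar: "sstar \<in> {2..p}" "real sstar \<le> real p / (2 * exp 1)"
    and \<theta>: "theta n p X (2 * sstar) 7 > 0" and q: "1 \<le> q" "q \<le> 2"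
    and C0: "C0 = 49 * (4 + sqrt 2) / (4 * (theta n p X (2 * sstar) 7)\<^sup>2)"
    and est: "\<forall>s\<in>{1..p}. lasso_estimator n p X (lambda n p \<sigma> s) (bhat s)"
    and s: "s \<in> {1..sstar}"
  show "(SUP \<beta>\<in>B0 p s. measure (obs_law n p \<sigma> X \<beta>)
       {y \<in> rvec n. lq_norm p q (vsub p (beta_tilde n p \<sigma> q C0 sstar bhat y) \<beta>)
          \<ge> 89 * C0 * \<sigma> * real s powr (1 / q) * sqrt (ln (2 * exp 1 * real p / real s) / real n)})
    \<le> (2 * (log 2 (real p))\<^sup>2 + 1) * (2 * real s / real p) ^ (2 * s)"
  proof (rule cSUP_least)
    define z where "z = (\<lambda>j\<in>{1..p}. 0 :: real)"
    have "{j \<in> {1..p}. z j \<noteq> 0} = {}" by (auto simp: z_def)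
    then have "l0_norm p z = 0" unfolding l0_norm_def by (simp only: card.empty)
    then have "z \<in> B0 p s" by (simp add: B0_def rvec_def z_def)
    then show "B0 p s \<noteq> {}" by blast
  next
    fix \<beta> assume "\<beta> \<in> B0 p s"
    then show "measure (obs_law n p \<sigma> X \<beta>)
         {y \<in> rvec n. lq_norm p q (vsub p (beta_tilde n p \<sigma> q C0 sstar bhat y) \<beta>)
            \<ge> 89 * C0 * \<sigma> * real s powr (1 / q) * sqrt (ln (2 * exp 1 * real p / real s) / real n)}
      \<le> (2 * (log 2 (real p))\<^sup>2 + 1) * (2 * real s / real p) ^ (2 * s)"
      using lasso_adaptive_error_prob[OF n p \<sigma> col _ _ sstar(2) \<theta> q C0, of bhat s \<beta>] sstar(1) est s
      by (simp add: wfun_def mult.assoc)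
  qed
qed simp

end
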